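(* There are absolute constants $\epsilon_0>0$ and $c>0$ such that for all $0<\epsilon<\epsilon_0$, each of the following classes $\mathcal{H}$ satisfies the given lower bound for both $m^{\mathrm{test}}_\epsilon(\mathcal{H})$ and $q^{\mathrm{test}}_{0,\epsilon}(\mathcal{H})$: 1. For integers $n,k\ge1$, the class of degree-$k$ polynomial threshold functions on $\mathbb{R}^n$, i.e. functions $x\mapsto\mathrm{sign}(p(x))$ with $p$ a real polynomial in $n$ variables of degree at most $k$: lower bound $c\cdot\binom{n+k}{k}\big/\log\binom{n+k}{k}$. 2. For integers $n\ge2$, the class of balls in $\mathbb{R}^n$, i.e. functions $f:\mathbb{R}^n\to\{\pm1\}$ of the form $f(x)=\mathrm{sign}(t-\|x-z\|_2)$ with $t\in\mathbb{R}$, $z\in\mathbb{R}^n$: lower bound $c\cdot n/\log n$. 3. For integers $d\ge2$, the class of signs of trigonometric polynomials, i.e. functions $f:\mathbb{R}^2\to\{\pm1\}$ of the form $$f(x,y)=\mathrm{sign}\Big(t+\sum_{k=1}^d a_k\cos(kx)+\sum_{k=1}^d b_k\sin(kx)-y\Big)$$ with $t,a_k,b_k\in\mathbb{R}$: lower bound $c\cdot d/\log d$.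
   Context: $\mathrm{sign}(z)=1$ for $z\ge0$ and $-1$ otherwise. For a class $\mathcal{H}$ of two-valued functions on $\mathcal{X}$ and a probability distribution $\mathcal{D}$ on $\mathcal{X}$, $\mathrm{dist}_{\mathcal{D}}(f,g)=\Pr_{x\sim\mathcal{D}}[f(x)\ne g(x)]$ and $\mathrm{dist}_{\mathcal{D}}(f,\mathcal{H})=\inf_{h\in\mathcal{H}}\mathrm{dist}_{\mathcal{D}}(f,h)$. All testers are computationally unbounded randomized algorithms that must work for every unknown distribution $\mathcal{D}$ (all finitely supported distributions are allowed) and every unknown two-valued function $f$ on $\mathcal{X}$. (i) $m^{\mathrm{test}}_\epsilon(\mathcal{H})$ is the minimum $m$ such that some algorithm receiving $m$ labelled examples $(x,f(x))$, $x\sim\mathcal{D}$ independently, accepts with probability $\ge 2/3$ if $f\in\mathcal{H}$ and rejects with probability $\ge2/3$ if $\mathrm{dist}_{\mathcal{D}}(f,\mathcal{H})\ge\epsilon$. (ii) $q^{\mathrm{test}}_{0,\epsilon}(\mathcal{H})$ is the minimum $q$ such that some algorithm making in total at most $q$ adaptive queries to $f$ at arbitrary points of $\mathcal{X}$ and independent labelled samples $(x,f(x))$, $x\sim\mathcal{D}$, accepts with probability $\ge2/3$ if $\mathrm{dist}_{\mathcal{D}}(f,\mathcal{H})=0$ and rejects with probability $\ge2/3$ if $\mathrm{dist}_{\mathcal{D}}(f,\mathcal{H})\ge\epsilon$. *)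

theory Defs
  imports "HOL-Probability.Probability"
begin

text \<open>
  The domain \<open>X\<close> is the carrier \<open>space S\<close> of a measurable space \<open>S\<close>; a distribution on \<open>X\<close> is any
  probability measure with the measurable sets of \<open>S\<close>. Two-valued functions on \<open>X\<close> are the
  extensional functions into \<open>{-1, 1}\<close>. Probabilities are taken in completed measures, so that
  for a finitely supported distribution every function and every set of outcomes is measurable.
\<close>

definition distributions :: "'a measure \<Rightarrow> 'a measure set" where
  "distributions S = {D. prob_space D \<and> sets D = sets S}"

definition two_valued :: "'a measure \<Rightarrow> ('a \<Rightarrow> int) set" where
  "two_valued S = (space S \<rightarrow>\<^sub>E {-1, 1})"

definition fun_dist :: "'a measure \<Rightarrow> ('a \<Rightarrow> int) \<Rightarrow> ('a \<Rightarrow> int) \<Rightarrow> real" where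
  "fun_dist D f g = \<P>(x in completion D. f x \<noteq> g x)"

definition class_dist :: "'a measure \<Rightarrow> ('a \<Rightarrow> int) \<Rightarrow> ('a \<Rightarrow> int) set \<Rightarrow> real" where
  "class_dist D f H = (INF h\<in>H. fun_dist D f h)"

text \<open>
  The pairs of unknowns \<open>(D, f)\<close> a tester has to cope with: \<open>f\<close> has to be measurable for the
  completion of \<open>D\<close>, since otherwise its distances are undefined. This is no restriction
  for finitely supported \<open>D\<close>.
\<close>

definition instances :: "'a measure \<Rightarrow> ('a measure \<times> ('a \<Rightarrow> int)) set" where
  "instances S = {(D, f). D \<in> distributions S \<and> f \<in> two_valued S \<and>
     f \<in> measurable (completion D) (count_space UNIV)}"

text \<open>
  Randomness of an execution: the private randomness of the tester, drawn from an arbitrary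
  probability measure \<open>R\<close> on the reals, and \<open>m\<close> independent sample points from \<open>D\<close>.
  A randomized algorithm is a family, indexed by the private randomness, of arbitrary
  deterministic algorithms. Since non-measurable sets have \<open>measure\<close> 0, a lower bound \<open>2/3\<close> on
  the probability of an event includes the claim that this event is measurable.
\<close>

definition exec_space :: "real measure \<Rightarrow> 'a measure \<Rightarrow> nat \<Rightarrow> (real \<times> (nat \<Rightarrow> 'a)) measure" where
  "exec_space R D m = completion (R \<Otimes>\<^sub>M (\<Pi>\<^sub>M i\<in>{..<m}. D))"

definition labelled :: "('a \<Rightarrow> int) \<Rightarrow> nat \<Rightarrow> (nat \<Rightarrow> 'a) \<Rightarrow> ('a \<times> int) list" where
  "labelled f m s = map (\<lambda>i. (s i, f (s i))) [0..<m]"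

definition sample_tester ::
  "'a measure \<Rightarrow> real \<Rightarrow> ('a \<Rightarrow> int) set \<Rightarrow> nat \<Rightarrow> real measure \<Rightarrow>
   (real \<Rightarrow> ('a \<times> int) list \<Rightarrow> bool) \<Rightarrow> bool" where
  "sample_tester S \<epsilon> H m R A \<longleftrightarrow> prob_space R \<and>
     (\<forall>(D, f) \<in> instances S.
        (f \<in> H \<longrightarrow> \<P>((r, s) in exec_space R D m. A r (labelled f m s)) \<ge> 2/3) \<and>
        (class_dist D f H \<ge> \<epsilon> \<longrightarrow>
           \<P>((r, s) in exec_space R D m. \<not> A r (labelled f m s)) \<ge> 2/3))"

definition m_test :: "'a measure \<Rightarrow> real \<Rightarrow> ('a \<Rightarrow> int) set \<Rightarrow> enat" where
  "m_test S \<epsilon> H = Inf {enat m | m. \<exists>R A. sample_tester S \<epsilon> H m R A}"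

text \<open>
  Deterministic adaptive algorithms, as decision trees: stop with a verdict (\<open>True\<close> for accept),
  query \<open>f\<close> at a chosen point, or draw a fresh labelled sample. In \<open>run f s i t\<close>, the sample
  points \<open>s 0, \<dots>, s (i - 1)\<close> have been consumed already.
\<close>

datatype 'a strategy =
    Verdict bool
  | Query 'a "int \<Rightarrow> 'a strategy"
  | Draw "'a \<Rightarrow> int \<Rightarrow> 'a strategy"

primrec run :: "('a \<Rightarrow> int) \<Rightarrow> (nat \<Rightarrow> 'a) \<Rightarrow> nat \<Rightarrow> 'a strategy \<Rightarrow> bool" where
  "run f s i (Verdict b) = b"
| "run f s i (Query x k) = run f s i (k (f x))"
| "run f s i (Draw k) = run f s (Suc i) (k (s i) (f (s i)))"

text \<open>Queries are made in \<open>X\<close> only, and queries and samples together number at most \<open>q\<close>.\<close>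

primrec within_budget :: "'a set \<Rightarrow> nat \<Rightarrow> 'a strategy \<Rightarrow> bool" where
  "within_budget X q (Verdict b) = True"
| "within_budget X q (Query x k) =
     (q > 0 \<and> x \<in> X \<and> (\<forall>y\<in>{-1, 1}. within_budget X (q - 1) (k y)))"
| "within_budget X q (Draw k) =
     (q > 0 \<and> (\<forall>x\<in>X. \<forall>y\<in>{-1, 1}. within_budget X (q - 1) (k x y)))"

definition query_tester ::
  "'a measure \<Rightarrow> real \<Rightarrow> ('a \<Rightarrow> int) set \<Rightarrow> nat \<Rightarrow> real measure \<Rightarrow> (real \<Rightarrow> 'a strategy) \<Rightarrow> bool" where
  "query_tester S \<epsilon> H q R A \<longleftrightarrow> prob_space R \<and> (\<forall>r. within_budget (space S) q (A r)) \<and>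
     (\<forall>(D, f) \<in> instances S.
        (class_dist D f H = 0 \<longrightarrow> \<P>((r, s) in exec_space R D q. run f s 0 (A r)) \<ge> 2/3) \<and>
        (class_dist D f H \<ge> \<epsilon> \<longrightarrow>
           \<P>((r, s) in exec_space R D q. \<not> run f s 0 (A r)) \<ge> 2/3))"

definition q_test0 :: "'a measure \<Rightarrow> real \<Rightarrow> ('a \<Rightarrow> int) set \<Rightarrow> enat" where
  "q_test0 S \<epsilon> H = Inf {enat q | q. \<exists>R A. query_tester S \<epsilon> H q R A}"

text \<open>Unlike \<open>sgn\<close>, this is 1 at 0.\<close>

definition pm_sign :: "real \<Rightarrow> int" where
  "pm_sign z = (if z \<ge> 0 then 1 else -1)"

text \<open>
  Real \<open>n\<close>-space for a variable \<open>n\<close>, as extensional functions on \<open>{..<n}\<close>. The dimension must not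
  be a type, because the constants of the theorem have to be independent of it.
\<close>

abbreviation Rn :: "nat \<Rightarrow> (nat \<Rightarrow> real) measure" where
  "Rn n \<equiv> (\<Pi>\<^sub>M i\<in>{..<n}. borel)"

text \<open>Exponent vectors of the monomials in \<open>n\<close> variables of total degree at most \<open>k\<close>.\<close>

definition exponents :: "nat \<Rightarrow> nat \<Rightarrow> (nat \<Rightarrow> nat) set" where
  "exponents n k = {\<alpha> \<in> {..<n} \<rightarrow>\<^sub>E UNIV. (\<Sum>i<n. \<alpha> i) \<le> k}"

lemma finite_exponents: "finite (exponents n k)"
proof (rule finite_subset)
  show "exponents n k \<subseteq> {..<n} \<rightarrow>\<^sub>E {..k}"
  proof
    fix \<alpha> assume *: "\<alpha> \<in> exponents n k"
    have "\<alpha> i \<le> k" if "i < n" for i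
      using member_le_sum[of i "{..<n}" \<alpha>] that * by (auto simp: exponents_def)
    with * show "\<alpha> \<in> {..<n} \<rightarrow>\<^sub>E {..k}"
      by (auto simp: exponents_def PiE_iff)
  qed
qed (auto intro: finite_PiE)

definition poly_eval :: "nat \<Rightarrow> nat \<Rightarrow> ((nat \<Rightarrow> nat) \<Rightarrow> real) \<Rightarrow> (nat \<Rightarrow> real) \<Rightarrow> real" where
  "poly_eval n k a x = (\<Sum>\<alpha>\<in>exponents n k. a \<alpha> * (\<Prod>i<n. x i ^ \<alpha> i))"

definition PTF :: "nat \<Rightarrow> nat \<Rightarrow> ((nat \<Rightarrow> real) \<Rightarrow> int) set" where
  "PTF n k = {restrict (\<lambda>x. pm_sign (poly_eval n k a x)) (space (Rn n)) | a. True}"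

definition balls :: "nat \<Rightarrow> ((nat \<Rightarrow> real) \<Rightarrow> int) set" where
  "balls n = {restrict (\<lambda>x. pm_sign (t - L2_set (\<lambda>i. x i - z i) {..<n})) (space (Rn n)) | t z.
     z \<in> space (Rn n)}"

definition trig_signs :: "nat \<Rightarrow> (real \<times> real \<Rightarrow> int) set" where
  "trig_signs d = {\<lambda>(x, y). pm_sign (t + (\<Sum>k=1..d. a k * cos (real k * x))
      + (\<Sum>k=1..d. b k * sin (real k * x)) - y) | t a b. True}"

end

theory Submission
  imports Defs "HOL-Computational_Algebra.Polynomial"
begin

text \<open>
  Each class contains, on a suitable curve, the signs of a Chebyshev system of dimension \<open>D\<close>: any
  labels of \<open>D\<close> points of the curve are realised, but along the curve a member of the class changes
  sign only \<open>O(D)\<close> times. Fix \<open>4 D\<close> points on the curve with alternating labels \<open>f\<close>. If at most \<open>D\<close> of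
  them carry mass, then \<open>f\<close> agrees with a member of the class on the support; if all of them carry
  comparable mass, then \<open>f\<close> is far from the class. As \<open>f\<close> is fixed, queries are useless, and a
  tester has to distinguish the two kinds of distributions from samples only.

  The weights of the points are drawn independently from one of two laws on \<open>[0, \<Lambda>]\<close> with the same
  moments up to order \<open>L \<approx> log D\<close>, where \<open>\<Lambda> = O(L\<^sup>2)\<close>: one is mostly 0, the other is at least 1, and
  both have bounded mean. Samples from the normalised weights \<open>u\<close> arise by rejection: pick a point
  uniformly and keep it with probability \<open>u\<^sub>i / \<Lambda>\<close>. Unless some point is picked more than \<open>L\<close> times, the
  law of the transcript depends only on the matched moments, so \<open>c D L\<close> rounds, and hence
  \<open>c D / L\<close> samples, do not distinguish the two cases.
\<close>

section \<open>Sampling from random weights\<close>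

text \<open>The obstacle is normalisation: the law of a sample divides by the random sum of the
  weights, so the likelihood of the samples themselves is not polynomial in \<open>u\<close>, and
  matched moments say nothing about it. A rejection trial divides by the fixed bound \<Lambda>
  instead, and the points it keeps still have the normalised law. The price is a keeping probability
  that may be as small as 1/\<Lambda>. The constants: among 2 D disjoint pairs of neighbouring
  points a member of the class can fit at most D, so it errs at least D times; with weights at least
  1 and total weight at most 60 * 4 D this is a distance of 1/240. The threshold 2/3 survives them,
  because 31/60 + 3/5 > 1.\<close>

definition wsum :: "('a \<Rightarrow> 'b :: comm_semiring_1) \<Rightarrow> 'a set \<Rightarrow> nat \<Rightarrow> ('a list \<Rightarrow> 'b) \<Rightarrow> 'b" where
  "wsum v Z n \<phi> = (\<Sum>l | set l \<subseteq> Z \<and> length l = n. prod_list (map v l) * \<phi> l)"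

lemma wsum_0 [simp]: "wsum v Z 0 \<phi> = \<phi> []"
proof -
  have "{l. set l \<subseteq> Z \<and> length l = 0} = {[]}" by auto
  then show ?thesis by (simp add: wsum_def)
qed

lemma wsum_Suc:
  assumes "finite Z"
  shows "wsum v Z (Suc n) \<phi> = (\<Sum>z\<in>Z. v z * wsum v Z n (\<lambda>l. \<phi> (z # l)))"
proof -
  let ?L = "\<lambda>n. {l. set l \<subseteq> Z \<and> length l = n}"
  have "bij_betw (\<lambda>(z, l). z # l) (Z \<times> ?L n) (?L (Suc n))"
    by (rule bij_betw_byWitness[where f' = "\<lambda>l. (hd l, tl l)"])
      (auto simp: length_Suc_conv subset_iff)
  then have "wsum v Z (Suc n) \<phi> = (\<Sum>(z, l)\<in>Z \<times> ?L n. prod_list (map v (z # l)) * \<phi> (z # l))"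
    unfolding wsum_def by (subst sum.reindex_bij_betw[symmetric]) (auto simp: case_prod_unfold)
  also have "\<dots> = (\<Sum>z\<in>Z. \<Sum>l\<in>?L n. v z * (prod_list (map v l) * \<phi> (z # l)))"
    by (subst sum.cartesian_product) (simp add: mult.assoc case_prod_unfold)
  finally show ?thesis by (simp add: wsum_def sum_distrib_left)
qed

text \<open>The product measure over \<open>{..<Suc m}\<close> splits off its last factor, so the
  integral over samples in \<open>nn_integral_samples\<close> unrolls from this end.\<close>

lemma wsum_Suc_snoc:
  assumes "finite Z"
  shows "wsum v Z (Suc n) \<phi> = (\<Sum>z\<in>Z. v z * wsum v Z n (\<lambda>l. \<phi> (l @ [z])))"
proof (induction n arbitrary: \<phi>)
  case 0
  show ?case by (simp add: wsum_Suc[OF assms])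
next
  case (Suc n)
  have "wsum v Z (Suc (Suc n)) \<phi> =
      (\<Sum>y\<in>Z. \<Sum>z\<in>Z. v y * (v z * wsum v Z n (\<lambda>l. \<phi> (y # l @ [z]))))"
    by (subst wsum_Suc[OF assms], subst Suc) (simp add: sum_distrib_left)
  also have "\<dots> = (\<Sum>z\<in>Z. v z * (\<Sum>y\<in>Z. v y * wsum v Z n (\<lambda>l. \<phi> (y # l @ [z]))))"
    by (subst sum.swap) (simp add: sum_distrib_left mult.left_commute)
  finally show ?case by (simp add: wsum_Suc[OF assms])
qed

text \<open>The hypothesis skips words of weight 0: in \<open>sample_tester_bound\<close> the two
  functions compared agree only on points that carry mass.\<close>

lemma wsum_cong:
  assumes "\<And>l. set l \<subseteq> Z \<Longrightarrow> length l = n \<Longrightarrow> prod_list (map v l) \<noteq> 0 \<Longrightarrow> \<phi> l = \<psi> l"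
  shows "wsum v Z n \<phi> = wsum v Z n \<psi>"
  unfolding wsum_def
proof (rule sum.cong)
  fix l assume "l \<in> {l. set l \<subseteq> Z \<and> length l = n}"
  then show "prod_list (map v l) * \<phi> l = prod_list (map v l) * \<psi> l"
    by (cases "prod_list (map v l) = 0") (auto simp: assms)
qed simp

lemma wsum_one:
  assumes "finite Z"
  shows "wsum v Z n (\<lambda>_. 1) = sum v Z ^ n"
  by (induction n) (simp_all add: wsum_Suc[OF assms] sum_distrib_right)

lemma prod_list_map_nonneg: "\<forall>z\<in>set l. 0 \<le> v z \<Longrightarrow> 0 \<le> prod_list (map v l)"
  for v :: "'a \<Rightarrow> real"
  by (induction l) auto

lemma wsum_mono:
  fixes v :: "'a \<Rightarrow> real"
  assumes "\<And>z. z \<in> Z \<Longrightarrow> 0 \<le> v z" "\<And>l. set l \<subseteq> Z \<Longrightarrow> length l = n \<Longrightarrow> \<phi> l \<le> \<psi> l"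
  shows "wsum v Z n \<phi> \<le> wsum v Z n \<psi>"
  unfolding wsum_def
  using assms by (intro sum_mono mult_left_mono prod_list_map_nonneg) auto

lemma wsum_nonneg:
  fixes v :: "'a \<Rightarrow> real"
  assumes "\<And>z. z \<in> Z \<Longrightarrow> 0 \<le> v z" "\<And>l. set l \<subseteq> Z \<Longrightarrow> length l = n \<Longrightarrow> 0 \<le> \<phi> l"
  shows "0 \<le> wsum v Z n \<phi>"
  using wsum_mono[of Z v n "\<lambda>_. 0" \<phi>] assms by (simp add: wsum_def)

lemma wsum_add: "wsum v Z n (\<lambda>l. \<phi> l + \<psi> l) = wsum v Z n \<phi> + wsum v Z n \<psi>"
  by (simp add: wsum_def sum.distrib distrib_left)

lemma wsum_scale: "wsum v Z n (\<lambda>l. c * \<phi> l) = c * wsum v Z n \<phi>"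
  by (simp add: wsum_def sum_distrib_left mult.left_commute)

lemma wsum_sum: "wsum v Z n (\<lambda>l. \<Sum>i\<in>I. \<phi> i l) = (\<Sum>i\<in>I. wsum v Z n (\<phi> i))"
  unfolding wsum_def by (subst sum.swap) (simp add: sum_distrib_left)

section \<open>Rejection trials and the load of a point\<close>

definition trial :: "nat \<Rightarrow> real \<Rightarrow> (nat \<Rightarrow> real) \<Rightarrow> nat \<times> bool \<Rightarrow> real" where
  "trial M \<Lambda> u z = (if snd z then u (fst z) / \<Lambda> else 1 - u (fst z) / \<Lambda>) / real M"

abbreviation outcomes :: "nat \<Rightarrow> (nat \<times> bool) set" where
  "outcomes M \<equiv> {..<M} \<times> UNIV"

lemma sum_outcomes: "(\<Sum>z\<in>outcomes M. F z) = (\<Sum>i<M. F (i, True) + F (i, False))"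
  for F :: "nat \<times> bool \<Rightarrow> real"
proof -
  have "(\<Sum>z\<in>outcomes M. F z) = (\<Sum>i<M. \<Sum>b\<in>UNIV. F (i, b))"
    by (subst sum.cartesian_product) simp
  then show ?thesis by (simp add: UNIV_bool add.commute)
qed

lemma trial_nonneg:
  assumes "\<And>i. i < M \<Longrightarrow> 0 \<le> u i \<and> u i \<le> \<Lambda>" "0 < \<Lambda>" "z \<in> outcomes M"
  shows "0 \<le> trial M \<Lambda> u z"
  using assms by (auto simp: trial_def)

text \<open>Discarded picks count too: a kept and a discarded pick of \<open>i\<close> both
  contribute a factor that is linear in \<open>u i\<close>.\<close>

definition load :: "nat \<Rightarrow> (nat \<times> bool) list \<Rightarrow> nat" where
  "load i l = length (filter (\<lambda>z. fst z = i) l)"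

text \<open>Exponential moment: whatever \<open>u\<close> is, each trial picks \<open>i\<close> with
  probability 1/M, so the mean of \<open>2 ^ load i l\<close> factorises over the trials. Markov's
  inequality at \<open>2 ^ Suc L\<close> and a union bound over the points finish.\<close>

lemma overload_bound:
  assumes u: "\<And>i. i < M \<Longrightarrow> 0 \<le> u i \<and> u i \<le> \<Lambda>" "0 < \<Lambda>"
  shows "wsum (trial M \<Lambda> u) (outcomes M) T (\<lambda>l. of_bool (\<exists>i<M. L < load i l))
           \<le> real M * (1 + 1 / real M) ^ T / 2 ^ Suc L"
proof -
  let ?v = "trial M \<Lambda> u"
  have one: "wsum ?v (outcomes M) T (\<lambda>l. 2 ^ load i l) = (1 + 1 / real M) ^ T" if "i < M" for i
  proof -
    let ?v' = "\<lambda>z. ?v z * (if fst z = i then 2 else 1)"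
    have "prod_list (map ?v l) * 2 ^ load i l = prod_list (map ?v' l)" for l
      by (induction l) (auto simp: load_def)
    then have "wsum ?v (outcomes M) T (\<lambda>l. 2 ^ load i l) = wsum ?v' (outcomes M) T (\<lambda>_. 1)"
      by (simp add: wsum_def)
    also have "\<dots> = (\<Sum>j<M. (if j = i then 2 else 1) / real M) ^ T"
      by (subst wsum_one, simp, subst sum_outcomes)
        (auto simp: trial_def add_divide_distrib[symmetric] diff_divide_distrib intro!: arg_cong[where f = "\<lambda>x. x ^ T"] sum.cong)
    also have "(\<Sum>j<M. (if j = i then 2 else 1) / real M) = (\<Sum>j<M. 1 / real M + (if j = i then 1 / real M else 0))"
      by (rule sum.cong) auto
    also have "\<dots> = 1 + 1 / real M"
      using that by (simp add: sum.distrib)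
    finally show ?thesis .
  qed
  have "of_bool (\<exists>i<M. L < load i l) \<le> (\<Sum>i<M. (1 / 2 ^ Suc L) * 2 ^ load i l :: real)" for l
  proof (cases "\<exists>i<M. L < load i l")
    case True
    then obtain i where i: "i < M" "Suc L \<le> load i l" by auto
    have "(2 :: real) ^ Suc L \<le> 2 ^ load i l" using i by (intro power_increasing) auto
    then have "1 \<le> (1 / 2 ^ Suc L) * (2 :: real) ^ load i l" by (simp add: field_simps)
    also have "\<dots> \<le> (\<Sum>i<M. (1 / 2 ^ Suc L) * 2 ^ load i l)"
      using i by (intro member_le_sum) auto
    finally show ?thesis using True by simp
  next
    case False
    then have "of_bool (\<exists>i<M. L < load i l) = (0 :: real)" by simp
    also have "\<dots> \<le> (\<Sum>i<M. (1 / 2 ^ Suc L) * 2 ^ load i l)" by (rule sum_nonneg) simp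
    finally show ?thesis .
  qed
  then have "wsum ?v (outcomes M) T (\<lambda>l. of_bool (\<exists>i<M. L < load i l))
      \<le> wsum ?v (outcomes M) T (\<lambda>l. \<Sum>i<M. (1 / 2 ^ Suc L) * 2 ^ load i l)"
    using trial_nonneg[of M u \<Lambda>, OF u] by (intro wsum_mono) auto
  also have "\<dots> = real M * (1 + 1 / real M) ^ T / 2 ^ Suc L"
    by (simp only: wsum_sum wsum_scale) (simp add: one)
  finally show ?thesis .
qed

section \<open>Independent random weights and matching moments\<close>

definition mixture ::
  "nat \<Rightarrow> real set \<Rightarrow> (real \<Rightarrow> real) \<Rightarrow> ((nat \<Rightarrow> real) \<Rightarrow> real) \<Rightarrow> real" where
  "mixture M X P F = (\<Sum>u\<in>{..<M} \<rightarrow>\<^sub>E X. (\<Prod>i<M. P (u i)) * F u)"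

text \<open>Sorting the trials by point makes the likelihood a product over coordinates, hence its
  mean over independent coordinates a product of means.\<close>

lemma prod_list_group:
  fixes f :: "nat \<times> bool \<Rightarrow> real"
  assumes "set l \<subseteq> outcomes M"
  shows "prod_list (map f l) = (\<Prod>i<M. prod_list (map f (filter (\<lambda>z. fst z = i) l)))"
  using assms
proof (induction l)
  case (Cons z l)
  have "(\<Prod>i<M. prod_list (map f (filter (\<lambda>z. fst z = i) (z # l))))
      = (\<Prod>i<M. (if i = fst z then f z else 1) * prod_list (map f (filter (\<lambda>z. fst z = i) l)))"
    by (rule prod.cong) auto
  also have "\<dots> = f z * prod_list (map f l)"
    using Cons by (auto simp: prod.distrib)
  finally show ?case by simp
qed simp

text \<open>
  The likelihood of a transcript is, in each coordinate of \<open>u\<close>, a polynomial whose degree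
  is the load of that coordinate; so the moments up to order \<open>L\<close> determine its mean.
\<close>

lemma mixture_likelihood_eq:
  assumes X: "finite X"
    and mom: "\<And>j. j \<le> L \<Longrightarrow> (\<Sum>x\<in>X. P x * x ^ j) = (\<Sum>x\<in>X. Q x * x ^ j)"
    and l: "set l \<subseteq> outcomes M" "\<And>i. i < M \<Longrightarrow> load i l \<le> L"
  shows "mixture M X P (\<lambda>u. prod_list (map (trial M \<Lambda> u) l))
       = mixture M X Q (\<lambda>u. prod_list (map (trial M \<Lambda> u) l))"
proof -
  define lin where
    "lin b = (if b then [:0, 1 / (\<Lambda> * real M):] else [:1 / real M, - 1 / (\<Lambda> * real M):])" for b
  define p where "p i = prod_list (map (\<lambda>z. lin (snd z)) (filter (\<lambda>z. fst z = i) l))" for i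
  have deg: "degree (prod_list (map (\<lambda>z. lin (snd z)) k)) \<le> length k" for k :: "(nat \<times> bool) list"
  proof (induction k)
    case (Cons z k)
    have "degree (lin (snd z)) \<le> 1" by (auto simp: lin_def)
    then show ?case
      using Cons degree_mult_le[of "lin (snd z)" "prod_list (map (\<lambda>z. lin (snd z)) k)"] by auto
  qed simp
  have lin_ev: "poly (lin b) x = (if b then x / \<Lambda> else 1 - x / \<Lambda>) / real M" for b x
    by (simp add: lin_def diff_divide_distrib)
  have ev: "prod_list (map (trial M \<Lambda> u) k) = poly (prod_list (map (\<lambda>z. lin (snd z)) k)) (u i)"
    if "\<forall>z\<in>set k. fst z = i" for u i k
    using that
    by (induction k) (auto simp: trial_def lin_ev)
  have lik: "prod_list (map (trial M \<Lambda> u) l) = (\<Prod>i<M. poly (p i) (u i))" for u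
    unfolding prod_list_group[OF l(1)] p_def by (rule prod.cong) (auto intro!: ev)
  have mix: "mixture M X R (\<lambda>u. prod_list (map (trial M \<Lambda> u) l)) =
      (\<Prod>i<M. \<Sum>x\<in>X. R x * poly (p i) x)" for R
    unfolding mixture_def lik prod.distrib[symmetric]
    by (subst prod_sum_PiE) (use X in auto)
  have "(\<Sum>x\<in>X. P x * poly (p i) x) = (\<Sum>x\<in>X. Q x * poly (p i) x)" if "i < M" for i
  proof -
    have d: "degree (p i) \<le> L"
      using deg[of "filter (\<lambda>z. fst z = i) l"] l(2)[OF that] by (simp add: p_def load_def)
    have "(\<Sum>x\<in>X. R x * poly (p i) x) = (\<Sum>j\<le>degree (p i). coeff (p i) j * (\<Sum>x\<in>X. R x * x ^ j))" for R
      unfolding poly_altdef sum_distrib_left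
      by (subst sum.swap) (simp add: mult_ac)
    then show ?thesis using mom d by simp
  qed
  then show ?thesis unfolding mix by simp
qed

lemma mixture_sum_one:
  assumes "finite X" "(\<Sum>x\<in>X. P x) = 1"
  shows "mixture M X P (\<lambda>_. 1) = 1"
  unfolding mixture_def using prod_sum_PiE[of "{..<M}" "\<lambda>_. X" "\<lambda>_. P"] assms by simp

lemma mixture_mono:
  assumes "\<And>x. x \<in> X \<Longrightarrow> 0 \<le> P x" "\<And>u. u \<in> {..<M} \<rightarrow>\<^sub>E X \<Longrightarrow> F u \<le> G u"
  shows "mixture M X P F \<le> mixture M X P G"
  unfolding mixture_def
  using assms by (intro sum_mono mult_left_mono prod_nonneg) (auto simp: PiE_iff)

lemma mixture_add: "mixture M X P (\<lambda>u. F u + G u) = mixture M X P F + mixture M X P G"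
  by (simp add: mixture_def sum.distrib distrib_left)

lemma mixture_scale: "mixture M X P (\<lambda>u. c * F u) = c * mixture M X P F"
  by (simp add: mixture_def sum_distrib_left mult.left_commute)

lemma mixture_sum: "mixture M X P (\<lambda>u. \<Sum>i\<in>I. F i u) = (\<Sum>i\<in>I. mixture M X P (F i))"
  unfolding mixture_def by (subst sum.swap) (simp add: sum_distrib_left)

lemma mixture_coordinate:
  assumes "finite X" "(\<Sum>x\<in>X. P x) = 1" "i < M"
  shows "mixture M X P (\<lambda>u. F (u i)) = (\<Sum>x\<in>X. P x * F x)"
proof -
  have "(\<Prod>j<M. P (u j)) * F (u i) = (\<Prod>j<M. P (u j) * (if j = i then F (u j) else 1))" for u
    using assms(3) by (simp add: prod.distrib)
  then have "mixture M X P (\<lambda>u. F (u i)) = (\<Prod>j<M. \<Sum>x\<in>X. P x * (if j = i then F x else 1))"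
    unfolding mixture_def by (subst prod_sum_PiE) (use assms in auto)
  also have "\<dots> = (\<Prod>j<M. if j = i then (\<Sum>x\<in>X. P x * F x) else 1)"
    using assms by (intro prod.cong) auto
  finally show ?thesis using assms(3) by simp
qed

text \<open>Transcripts without an overloaded point have the same mean likelihood under both laws;
  the others have total mass at most the overload bound, uniformly in \<open>u\<close>. One
  inequality suffices, as it is applied with \<open>P\<close> and \<open>Q\<close> in both
  orders.\<close>

lemma mixture_indistinguishable:
  assumes X: "finite X" "\<And>x. x \<in> X \<Longrightarrow> 0 \<le> x \<and> x \<le> \<Lambda>" "0 < \<Lambda>"
    and P: "\<And>x. x \<in> X \<Longrightarrow> 0 \<le> P x" "(\<Sum>x\<in>X. P x) = 1"
    and Q: "\<And>x. x \<in> X \<Longrightarrow> 0 \<le> Q x"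
    and mom: "\<And>j. j \<le> L \<Longrightarrow> (\<Sum>x\<in>X. P x * x ^ j) = (\<Sum>x\<in>X. Q x * x ^ j)"
    and \<phi>: "\<And>l. 0 \<le> \<phi> l \<and> \<phi> l \<le> 1"
  shows "mixture M X P (\<lambda>u. wsum (trial M \<Lambda> u) (outcomes M) T \<phi>)
       \<le> mixture M X Q (\<lambda>u. wsum (trial M \<Lambda> u) (outcomes M) T \<phi>)
         + real M * (1 + 1 / real M) ^ T / 2 ^ Suc L"
    (is "?mix P \<phi> \<le> ?mix Q \<phi> + ?\<omega>")
proof -
  define over :: "(nat \<times> bool) list \<Rightarrow> real" where "over l = of_bool (\<exists>i<M. L < load i l)" for l
  have u: "\<And>i. i < M \<Longrightarrow> 0 \<le> u i \<and> u i \<le> \<Lambda>" if "u \<in> {..<M} \<rightarrow>\<^sub>E X" for u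
    using that X(2) by (auto simp: PiE_iff)
  have nonneg: "0 \<le> trial M \<Lambda> u z" if "u \<in> {..<M} \<rightarrow>\<^sub>E X" "z \<in> outcomes M" for u z
    using trial_nonneg[OF u[OF that(1)] X(3) that(2)] .
  have swap: "?mix R \<psi> = (\<Sum>l | set l \<subseteq> outcomes M \<and> length l = T.
      \<psi> l * mixture M X R (\<lambda>u. prod_list (map (trial M \<Lambda> u) l)))" for R \<psi>
    unfolding mixture_def wsum_def sum_distrib_left by (subst sum.swap) (simp add: mult_ac)
  have eq: "?mix P (\<lambda>l. \<phi> l * (1 - over l)) = ?mix Q (\<lambda>l. \<phi> l * (1 - over l))"
    unfolding swap
  proof (rule sum.cong[OF refl])
    fix l :: "(nat \<times> bool) list" assume l: "l \<in> {l. set l \<subseteq> outcomes M \<and> length l = T}"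
    show "\<phi> l * (1 - over l) * mixture M X P (\<lambda>u. prod_list (map (trial M \<Lambda> u) l)) =
        \<phi> l * (1 - over l) * mixture M X Q (\<lambda>u. prod_list (map (trial M \<Lambda> u) l))"
    proof (cases "\<exists>i<M. L < load i l")
      case False
      then have "load i l \<le> L" if "i < M" for i using that by (meson not_less)
      then show ?thesis using mixture_likelihood_eq[of X L P Q l M \<Lambda>] X(1) mom l by simp
    qed (simp add: over_def)
  qed
  have "?mix P \<phi> \<le> ?mix P (\<lambda>l. \<phi> l * (1 - over l) + over l)"
    using \<phi> nonneg P(1) by (intro mixture_mono wsum_mono) (auto simp: over_def)
  also have "\<dots> = ?mix Q (\<lambda>l. \<phi> l * (1 - over l)) + ?mix P over"
    by (simp add: wsum_add mixture_add eq)
  also have "?mix Q (\<lambda>l. \<phi> l * (1 - over l)) \<le> ?mix Q \<phi>"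
    using \<phi> nonneg Q by (intro mixture_mono wsum_mono) (auto simp: over_def)
  also have "?mix P over \<le> mixture M X P (\<lambda>_. ?\<omega> * 1)"
  proof (rule mixture_mono[OF P(1)])
    fix u' assume u': "u' \<in> {..<M} \<rightarrow>\<^sub>E X"
    show "wsum (trial M \<Lambda> u') (outcomes M) T over \<le> ?\<omega> * 1"
      using overload_bound[of M u' \<Lambda> T L] u[OF u'] X(3) by (simp flip: over_def)
  qed
  also have "\<dots> = ?\<omega>"
    using mixture_sum_one[OF X(1) P(2)] by (simp only: mixture_scale)
  finally show ?thesis by simp
qed

section \<open>Simulating samples by rejection\<close>

definition kept :: "(nat \<times> bool) list \<Rightarrow> nat list" where
  "kept l = map fst (filter snd l)"

text \<open>The value 0 when too few trials are kept makes such a transcript count neither as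
  acceptance nor as rejection.\<close>

definition simulate :: "nat \<Rightarrow> (nat list \<Rightarrow> real) \<Rightarrow> (nat \<times> bool) list \<Rightarrow> real" where
  "simulate m a l = (if m \<le> length (kept l) then a (take m (kept l)) else 0)"

text \<open>The probability of at least \<open>m\<close> successes in \<open>T\<close> independent trials of success probability \<open>p\<close>.\<close>

fun enough :: "real \<Rightarrow> nat \<Rightarrow> nat \<Rightarrow> real" where
  "enough p T 0 = 1"
| "enough p 0 (Suc m) = 0"
| "enough p (Suc T) (Suc m) = p * enough p T m + (1 - p) * enough p T (Suc m)"

lemma enough_nonneg: "0 \<le> p \<Longrightarrow> p \<le> 1 \<Longrightarrow> 0 \<le> enough p T m"
  by (induction p T m rule: enough.induct) auto

text \<open>Chernoff bound for the number K of successes: E 2^(-K) = (1 - p/2)^T, while K < m means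
  2^(m-K) > 1. In the induction, p 2^m + (1 - p) 2^(m+1) = 2^(m+1) (1 - p/2).\<close>

lemma enough_ge: "0 \<le> p \<Longrightarrow> p \<le> 1 \<Longrightarrow> 1 - 2 ^ m * (1 - p / 2) ^ T \<le> enough p T m"
proof (induction p T m rule: enough.induct)
  case (2 p m)
  then show ?case using one_le_power[of "2 :: real" "Suc m"] by simp
next
  case (3 p T m)
  have "p * (1 - 2 ^ m * (1 - p / 2) ^ T) + (1 - p) * (1 - 2 ^ Suc m * (1 - p / 2) ^ T)
      \<le> enough p (Suc T) (Suc m)"
    using 3 by (auto intro!: add_mono mult_left_mono)
  then show ?case by (simp add: algebra_simps)
qed simp

text \<open>A trial is kept with probability W / (M \<Lambda>), and the point of a kept trial has
  law u / W. The number of kept trials is independent of their points, which gives the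
  product.\<close>

lemma wsum_simulate:
  fixes u :: "nat \<Rightarrow> real"
  assumes M: "0 < M" and \<Lambda>: "0 < \<Lambda>" and u: "\<And>i. i < M \<Longrightarrow> 0 \<le> u i"
  defines "W \<equiv> (\<Sum>i<M. u i)"
  shows "wsum (trial M \<Lambda> u) (outcomes M) T (simulate m a) =
         enough (W / (real M * \<Lambda>)) T m * wsum (\<lambda>i. u i / W) {..<M} m a"
proof (induction T arbitrary: m a)
  case 0
  show ?case by (cases m) (simp_all add: simulate_def kept_def)
next
  case (Suc T)
  let ?p = "W / (real M * \<Lambda>)"
  have dark: "(\<Sum>i<M. trial M \<Lambda> u (i, False)) = 1 - ?p"
    using M by (simp add: trial_def W_def sum_divide_distrib[symmetric] sum_subtractf diff_divide_distrib mult.commute)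
  \<comment> \<open>If \<open>W = 0\<close>, every \<open>u i\<close> vanishes and, with division by
    zero giving 0, both sides are 0.\<close>
  have light: "trial M \<Lambda> u (i, True) = ?p * (u i / W)" if "i < M" for i
  proof (cases "W = 0")
    case True
    then have "u i = 0" using that u sum_nonneg_eq_0_iff[of "{..<M}" u] by (auto simp: W_def)
    then show ?thesis by (simp add: trial_def)
  qed (simp add: trial_def mult.commute)
  show ?case
  proof (cases m)
    case 0
    have "simulate 0 a = (\<lambda>_. a [] * 1)" by (simp add: simulate_def fun_eq_iff)
    moreover have "(\<Sum>z\<in>outcomes M. trial M \<Lambda> u z) = 1"
      unfolding sum_outcomes sum.distrib dark using light
      by (cases "W = 0") (simp_all add: sum_divide_distrib[symmetric] flip: W_def)
    ultimately show ?thesis using 0 by (simp only: wsum_scale wsum_one[OF finite_cartesian_product[OF finite_lessThan finite]]) simp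
  next
    case (Suc m')
    have "wsum (trial M \<Lambda> u) (outcomes M) (Suc T) (simulate m a) =
        (\<Sum>i<M. trial M \<Lambda> u (i, True) * wsum (trial M \<Lambda> u) (outcomes M) T (simulate m' (\<lambda>l. a (i # l))) +
          trial M \<Lambda> u (i, False) * wsum (trial M \<Lambda> u) (outcomes M) T (simulate m a))"
    proof -
      have "simulate m a ((i, True) # l) = simulate m' (\<lambda>l. a (i # l)) l"
           "simulate m a ((i, False) # l) = simulate m a l" for i l
        by (simp_all add: simulate_def kept_def Suc)
      then show ?thesis by (simp add: wsum_Suc sum_outcomes)
    qed
    also have "\<dots> = ?p * enough ?p T m' * (\<Sum>i<M. u i / W * wsum (\<lambda>i. u i / W) {..<M} m' (\<lambda>l. a (i # l)))
        + (1 - ?p) * (enough ?p T m * wsum (\<lambda>i. u i / W) {..<M} m a)"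
    proof -
      have "(\<Sum>i<M. trial M \<Lambda> u (i, False) * C) = (1 - ?p) * C" for C
        by (simp add: sum_distrib_right[symmetric] dark)
      moreover have "(\<Sum>i<M. trial M \<Lambda> u (i, True) * (e * F i)) = ?p * e * (\<Sum>i<M. u i / W * F i)" for e F
        unfolding sum_distrib_left by (rule sum.cong) (auto simp: light)
      ultimately show ?thesis unfolding sum.distrib Suc.IH by metis
    qed
    also have "(\<Sum>i<M. u i / W * wsum (\<lambda>i. u i / W) {..<M} m' (\<lambda>l. a (i # l))) =
        wsum (\<lambda>i. u i / W) {..<M} m a"
      by (simp add: Suc wsum_Suc)
    finally show ?thesis by (simp add: Suc algebra_simps)
  qed
qed


text \<open>
  \<open>a\<close> and \<open>b\<close> are the acceptance and rejection probabilities of a tester on a given sample.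
  The bound on the support size under \<open>P\<close> and the one on the total weight under \<open>Q\<close> hold with
  high probability by Markov's inequality. The number of kept trials is only estimated under \<open>Q\<close>;
  under \<open>P\<close> the same estimate follows by indistinguishability.
\<close>

lemma support_size_indistinguishable:
  fixes \<Lambda> :: real
  assumes D: "1 \<le> D" "M = 4 * D"
    and X: "finite X" "\<And>x. x \<in> X \<Longrightarrow> 0 \<le> x \<and> x \<le> \<Lambda>" "0 < \<Lambda>" "\<And>x. x \<in> X \<Longrightarrow> x = 0 \<or> 1 \<le> x"
    and P: "\<And>x. 0 \<le> P x" "(\<Sum>x\<in>X. P x) = 1"
    and Q: "\<And>x. 0 \<le> Q x" "(\<Sum>x\<in>X. Q x) = 1"
    and mom: "\<And>j. j \<le> L \<Longrightarrow> (\<Sum>x\<in>X. P x * x ^ j) = (\<Sum>x\<in>X. Q x * x ^ j)"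
    and sparse: "(\<Sum>x\<in>X. P x * of_bool (x \<noteq> 0)) \<le> 1 / 80"
    and dense: "Q 0 = 0" "(\<Sum>x\<in>X. Q x * x) \<le> 3"
    and ab: "\<And>l. 0 \<le> a l" "\<And>l. 0 \<le> b l" "\<And>l. a l + b l \<le> 1"
    and close: "\<And>w. (\<And>i. i < M \<Longrightarrow> 0 \<le> w i) \<Longrightarrow> 0 < sum w {..<M} \<Longrightarrow>
      card {i. i < M \<and> w i \<noteq> 0} \<le> D \<Longrightarrow>
      2 / 3 \<le> wsum (\<lambda>i. w i / sum w {..<M}) {..<M} m a"
    and far: "\<And>w. (\<And>i. i < M \<Longrightarrow> 1 \<le> w i) \<Longrightarrow> sum w {..<M} \<le> 60 * real M \<Longrightarrow>
      2 / 3 \<le> wsum (\<lambda>i. w i / sum w {..<M}) {..<M} m b"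
    and overload: "real M * (1 + 1 / real M) ^ T / 2 ^ Suc L \<le> 1 / 20"
  shows "1 / 20 < 2 ^ m * (1 - 1 / (2 * \<Lambda>)) ^ T"
proof (rule ccontr)
  \<comment> \<open>Otherwise, at a keeping probability of at least 1/\<Lambda>, which dense weights
    guarantee, \<open>T\<close> trials yield fewer than \<open>m\<close> samples with probability at
    most 1/20.\<close>
  assume "\<not> ?thesis"
  then have scarce: "2 ^ m * (1 - 1 / (2 * \<Lambda>)) ^ T \<le> 1 / 20" by simp
  have M: "0 < M" using D by simp
  define E where "E u \<phi> = wsum (trial M \<Lambda> u) (outcomes M) T \<phi>" for u \<phi>
  let ?one = "\<lambda>_ :: nat list. 1 :: real"
  let ?U = "{..<M} \<rightarrow>\<^sub>E X"
  have u: "\<And>i. i < M \<Longrightarrow> 0 \<le> u i \<and> u i \<le> \<Lambda>" if "u \<in> ?U" for u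
    using that X(2) by (auto simp: PiE_iff)
  have E_mono: "E u \<phi> \<le> E u \<psi>" if "u \<in> ?U" "\<And>l. \<phi> l \<le> \<psi> l" for u \<phi> \<psi>
    unfolding E_def using that trial_nonneg[OF u[OF that(1)] X(3)] by (intro wsum_mono) auto
  have E_one: "E u (\<lambda>_. 1) = 1" if "u \<in> ?U" for u
  proof -
    have "(\<Sum>z\<in>outcomes M. trial M \<Lambda> u z) = (\<Sum>i<M. 1 / real M)"
      unfolding sum_outcomes
      by (simp add: trial_def add_divide_distrib[symmetric] del: divide_divide_eq_left)
    then show ?thesis unfolding E_def using M by (simp add: wsum_one)
  qed
  have a1: "a l \<le> 1" for l using ab(2)[of l] ab(3)[of l] by linarith
  have b1: "b l \<le> 1" for l using ab(1)[of l] ab(3)[of l] by linarith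
  have E_simulate: "E u (simulate m c) =
      enough (sum u {..<M} / (real M * \<Lambda>)) T m * wsum (\<lambda>i. u i / sum u {..<M}) {..<M} m c"
    if "u \<in> ?U" for u c
    unfolding E_def using wsum_simulate[OF M X(3)] u[OF that] by blast
  have E_bounds: "0 \<le> E u (simulate m c) \<and> E u (simulate m c) \<le> E u (simulate m ?one) \<and> E u (simulate m c) \<le> 1"
    if "u \<in> ?U" "\<And>l. 0 \<le> c l \<and> c l \<le> 1" for u c
    using E_mono[OF that(1), of "\<lambda>_. 0" "simulate m c"] E_mono[OF that(1), of "simulate m c" "\<lambda>_. 1"]
      E_mono[OF that(1), of "simulate m c" "simulate m ?one"] that(2) E_one[OF that(1)]
    by (auto simp: simulate_def) (auto simp: E_def wsum_def)
  have W: "0 \<le> sum u {..<M}" "sum u {..<M} \<le> real M * \<Lambda>" if "u \<in> ?U" for u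
    using u[OF that] sum_bounded_above[of "{..<M}" u \<Lambda>] by (auto intro: sum_nonneg)
  have norm: "wsum (\<lambda>i. u i / sum u {..<M}) {..<M} m ?one = 1" if "0 < sum u {..<M}" for u
    using that by (simp add: wsum_one sum_divide_distrib[symmetric])
  have ind: "mixture M X P (\<lambda>u. E u \<phi>) \<le> mixture M X Q (\<lambda>u. E u \<phi>) + 1 / 20"
       and ind': "mixture M X Q (\<lambda>u. E u \<phi>) \<le> mixture M X P (\<lambda>u. E u \<phi>) + 1 / 20"
    if "\<And>l. 0 \<le> \<phi> l \<and> \<phi> l \<le> 1" for \<phi>
    using mixture_indistinguishable[OF X(1-3) P(1,2) Q(1) mom that]
      mixture_indistinguishable[OF X(1-3) Q(1,2) P(1) mom[symmetric] that] overload
    unfolding E_def by (meson add_left_mono order.trans)+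
  have sim_bounds: "0 \<le> simulate m c l \<and> simulate m c l \<le> 1" if "\<And>l. 0 \<le> c l \<and> c l \<le> 1" for c l
    using that by (simp add: simulate_def)

  have full: "1 \<le> u i" if "u \<in> ?U" "(\<Prod>i<M. Q (u i)) \<noteq> 0" "i < M" for u i
  proof -
    have "Q (u i) \<noteq> 0" using that by auto
    then have "u i \<noteq> 0" using dense(1) by metis
    moreover have "u i \<in> X" using that by auto
    ultimately show ?thesis using X(4) by blast
  qed
  have Q_mono: "mixture M X Q F \<le> mixture M X Q G"
    if "\<And>u. u \<in> ?U \<Longrightarrow> (\<And>i. i < M \<Longrightarrow> 1 \<le> u i) \<Longrightarrow> F u \<le> G u" for F G
    unfolding mixture_def
  proof (rule sum_mono)
    fix u assume u': "u \<in> ?U"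
    show "(\<Prod>i<M. Q (u i)) * F u \<le> (\<Prod>i<M. Q (u i)) * G u"
    proof (cases "(\<Prod>i<M. Q (u i)) = 0")
      case False
      have "F u \<le> G u" by (rule that[OF u' full[OF u' False]])
      then show ?thesis by (rule mult_left_mono) (simp add: Q(1) prod_nonneg)
    next
      case True
      show ?thesis unfolding True by simp
    qed
  qed
  have const: "mixture M X Q (\<lambda>_. c) = c" "mixture M X P (\<lambda>_. c) = c" for c
    using mixture_scale[of M X _ c "\<lambda>_. 1"] mixture_sum_one[OF X(1) Q(2)] mixture_sum_one[OF X(1) P(2)]
    by simp_all

  have enough_Q: "19 / 20 \<le> E u (simulate m ?one)" if "u \<in> ?U" "\<And>i. i < M \<Longrightarrow> 1 \<le> u i" for u
  proof -
    let ?p = "sum u {..<M} / (real M * \<Lambda>)"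
    have S: "real M \<le> sum u {..<M}"
      using that(2) sum_bounded_below[of "{..<M}" 1 u] by simp
    have p: "1 / \<Lambda> \<le> ?p" "?p \<le> 1"
      using S W[OF that(1)] X(3) M by (auto simp: field_simps)
    have "(1 - ?p / 2) ^ T \<le> (1 - 1 / (2 * \<Lambda>)) ^ T"
      using p by (intro power_mono) (auto simp: field_simps)
    then have "2 ^ m * (1 - ?p / 2) ^ T \<le> 1 / 20"
      using scarce by (meson mult_left_mono order.trans zero_le_numeral zero_le_power)
    moreover have "0 \<le> ?p" using W(1)[OF that(1)] X(3) by simp
    ultimately have "19 / 20 \<le> enough ?p T m"
      using enough_ge[of ?p m T] p by linarith
    then show ?thesis using E_simulate[OF that(1)] norm[of u] S M by simp
  qed

  \<comment> \<open>Markov's inequality in linear form: with S = W / (60 M), rejection has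
    probability at least 2/3 (19/20 - S) for each dense \<open>u\<close>, by \<open>far\<close> if S
    <= 1 and trivially otherwise. The mean of S is at most 3/60.\<close>
  have "2 / 3 * (19 / 20 - mixture M X Q (\<lambda>u. \<Sum>i<M. u i / (60 * real M)))
      \<le> mixture M X Q (\<lambda>u. E u (simulate m b))"
  proof -
    have "mixture M X Q (\<lambda>u. 2 / 3 * (19 / 20 + - 1 * (\<Sum>i<M. u i / (60 * real M))))
        \<le> mixture M X Q (\<lambda>u. E u (simulate m b))"
    proof (rule Q_mono)
      fix u assume *: "u \<in> ?U" "\<And>i. i < M \<Longrightarrow> 1 \<le> u i"
      have S: "(\<Sum>i<M. u i / (60 * real M)) = sum u {..<M} / (60 * real M)"
        by (simp add: sum_divide_distrib)
      show "2 / 3 * (19 / 20 + - 1 * (\<Sum>i<M. u i / (60 * real M))) \<le> E u (simulate m b)"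
      proof (cases "sum u {..<M} \<le> 60 * real M")
        case True
        let ?q = "enough (sum u {..<M} / (real M * \<Lambda>)) T m"
        have pos: "0 < sum u {..<M}" using sum_bounded_below[of "{..<M}" 1 u] *(2) M by simp
        have "19 / 20 \<le> ?q" using enough_Q[OF *] E_simulate[OF *(1)] norm[OF pos] by simp
        then have "2 / 3 * (19 / 20) \<le> ?q * wsum (\<lambda>i. u i / sum u {..<M}) {..<M} m b"
          using far[OF *(2) True] by (subst mult.commute, intro mult_mono) auto
        moreover have "0 \<le> (\<Sum>i<M. u i / (60 * real M))" using W(1)[OF *(1)] S by simp
        ultimately show ?thesis using E_simulate[OF *(1)] by simp
      next
        case False
        then have "1 \<le> (\<Sum>i<M. u i / (60 * real M))" unfolding S using M by simp
        then show ?thesis using E_bounds[OF *(1), of b] ab(2) b1 by auto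
      qed
    qed
    then show ?thesis by (simp only: mixture_scale mixture_add const) simp
  qed
  also have "mixture M X Q (\<lambda>u. \<Sum>i<M. u i / (60 * real M)) = (\<Sum>i<M. (\<Sum>x\<in>X. Q x * (x / (60 * real M))))"
    unfolding mixture_sum using mixture_coordinate[OF X(1) Q(2), of _ M "\<lambda>x. x / (60 * real M)"] by simp
  also have "\<dots> = (\<Sum>x\<in>X. Q x * x) / 60"
    using M by (simp add: sum_divide_distrib sum_distrib_left)
  finally have rej: "3 / 5 \<le> mixture M X Q (\<lambda>u. E u (simulate m b))"
    using dense(2) by simp

  \<comment> \<open>The same with the support size divided by D in place of S; its mean is at most
    4/80.\<close>
  have "2 / 3 * (mixture M X P (\<lambda>u. E u (simulate m ?one)) - mixture M X P (\<lambda>u. \<Sum>i<M. of_bool (u i \<noteq> 0) / real D))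
      \<le> mixture M X P (\<lambda>u. E u (simulate m a))"
  proof -
    have "mixture M X P (\<lambda>u. 2 / 3 * (E u (simulate m ?one) + - 1 * (\<Sum>i<M. of_bool (u i \<noteq> 0) / real D)))
        \<le> mixture M X P (\<lambda>u. E u (simulate m a))"
    proof (rule mixture_mono[OF P(1)])
      fix u assume *: "u \<in> ?U"
      have S: "(\<Sum>i<M. of_bool (u i \<noteq> 0) / real D) = real (card {i. i < M \<and> u i \<noteq> 0}) / real D"
        by (simp add: sum_divide_distrib[symmetric] Int_def)
      let ?q = "enough (sum u {..<M} / (real M * \<Lambda>)) T m"
      have q: "0 \<le> ?q" using W[OF *] M X(3) by (intro enough_nonneg) auto
      show "2 / 3 * (E u (simulate m ?one) + - 1 * (\<Sum>i<M. of_bool (u i \<noteq> 0) / real D)) \<le> E u (simulate m a)"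
      proof (cases "card {i. i < M \<and> u i \<noteq> 0} \<le> D")
        case True
        have nn: "0 \<le> (\<Sum>i<M. of_bool (u i \<noteq> 0) / real D :: real)" by (rule sum_nonneg) simp
        have "2 / 3 * E u (simulate m ?one) \<le> E u (simulate m a)"
        proof (cases "0 < sum u {..<M}")
          case pos: True
          have "2 / 3 \<le> wsum (\<lambda>i. u i / sum u {..<M}) {..<M} m a"
            using u[OF *] by (intro close pos True) auto
          then have "?q * (2 / 3) \<le> ?q * wsum (\<lambda>i. u i / sum u {..<M}) {..<M} m a"
            by (rule mult_left_mono[OF _ q])
          then show ?thesis using E_simulate[OF *] norm[OF pos] by simp
        next
          \<comment> \<open>\<open>close\<close> is silent when all weights are 0. Then nothing is
            ever kept, so for \<open>m > 0\<close> both sides are 0; for \<open>m = 0\<close> a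
            point mass shows that \<open>a []\<close> is at least 2/3.\<close>
          case False
          then have 0: "u i = 0" if "i < M" for i
            using u[OF *] that sum_pos2[of "{..<M}" i u] by force
          then have cong: "wsum (\<lambda>i. u i / sum u {..<M}) {..<M} m c = wsum (\<lambda>i. 0) {..<M} m c" for c :: "nat list \<Rightarrow> real"
            unfolding wsum_def by (intro sum.cong refl arg_cong2[where f = "(*)"] arg_cong[where f = prod_list] map_cong) auto
          show ?thesis
          proof (cases m)
            case 0
            have "sum (\<lambda>i. if i = 0 then 1 else 0) {..<M} = (1 :: real)" using M by simp
            moreover have "{i. i < M \<and> (if i = 0 then 1 else 0 :: real) \<noteq> 0} = {0}"
              using M by (auto split: if_splits)
            then have "card {i. i < M \<and> (if i = 0 then 1 else 0 :: real) \<noteq> 0} \<le> D"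
              using D(1) by (simp only: card.insert card.empty) simp
            ultimately have "2 / 3 \<le> a []"
              using close[of "\<lambda>i. if i = 0 then 1 else 0"] 0 by simp
            then show ?thesis using E_simulate[OF *] 0 by simp
          next
            case (Suc m')
            then show ?thesis unfolding E_simulate[OF *] cong by (simp add: wsum_Suc)
          qed
        qed
        then show ?thesis using nn by simp
      next
        case False
        then have "1 \<le> (\<Sum>i<M. of_bool (u i \<noteq> 0) / real D :: real)" unfolding S using D by simp
        then show ?thesis
          using E_bounds[OF *, of a] E_bounds[OF *, of ?one] ab(1) a1 by auto
      qed
    qed
    then show ?thesis by (simp only: mixture_scale mixture_add) simp
  qed
  also have "mixture M X P (\<lambda>u. \<Sum>i<M. of_bool (u i \<noteq> 0) / real D) =
      (\<Sum>i<M. (\<Sum>x\<in>X. P x * (of_bool (x \<noteq> 0) / real D)))"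
    unfolding mixture_sum using mixture_coordinate[OF X(1) P(2), of _ M "\<lambda>x. of_bool (x \<noteq> 0) / real D"] by simp
  also have "\<dots> = 4 * (\<Sum>x\<in>X. P x * of_bool (x \<noteq> 0))"
  proof -
    have "(\<Sum>x\<in>X. P x * (of_bool (x \<noteq> 0) / real D)) = (\<Sum>x\<in>X. P x * of_bool (x \<noteq> 0)) / real D"
      unfolding sum_divide_distrib by (simp only: times_divide_eq_right)
    then show ?thesis using D by (simp del: sum_mult_of_bool_eq)
  qed
  finally have "2 / 3 * (mixture M X P (\<lambda>u. E u (simulate m ?one)) - 1 / 20) \<le> mixture M X P (\<lambda>u. E u (simulate m a))"
    using sparse by (simp del: sum_mult_of_bool_eq)
  moreover have "19 / 20 \<le> mixture M X Q (\<lambda>u. E u (simulate m ?one))"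
    using Q_mono[of "\<lambda>_. 19 / 20" "\<lambda>u. E u (simulate m ?one)"] enough_Q by (simp add: const)
  \<comment> \<open>Each of the two transfers between the laws costs 1/20: 2/3 (19/20 - 1/20 - 1/20)
    - 1/20 = 31/60, which together with the 3/5 of \<open>rej\<close> exceeds 1.\<close>
  ultimately have acc: "31 / 60 \<le> mixture M X Q (\<lambda>u. E u (simulate m a))"
    using ind'[of "simulate m ?one", OF sim_bounds] ind[of "simulate m a", OF sim_bounds] ab(1) a1 by simp
  have "mixture M X Q (\<lambda>u. E u (simulate m a) + E u (simulate m b)) \<le> mixture M X Q (\<lambda>_. 1)"
  proof (rule mixture_mono[OF Q(1)])
    fix u assume *: "u \<in> ?U"
    have "E u (simulate m a) + E u (simulate m b) = E u (\<lambda>l. simulate m a l + simulate m b l)"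
      by (simp add: E_def wsum_add)
    also have "\<dots> \<le> E u (\<lambda>_. 1)" using ab(3) by (intro E_mono *) (simp add: simulate_def)
    finally show "E u (simulate m a) + E u (simulate m b) \<le> 1" using E_one[OF *] by simp
  qed
  then show False using acc rej by (simp add: mixture_add const)
qed

section \<open>Two laws with matching moments\<close>

text \<open>This is the coefficient of x^(card S - 1) in the Lagrange interpolant of
  \<open>p\<close> on \<open>S\<close>, and the interpolant is \<open>p\<close> itself, whose degree
  is smaller.\<close>

lemma sum_divided_difference_eq_0:
  fixes S :: "real set"
  assumes S: "finite S" and p: "degree p + 1 < card S"
  shows "(\<Sum>x\<in>S. poly p x / (\<Prod>y\<in>S - {x}. x - y)) = 0"
proof -
  define B where "B x = (\<Prod>y\<in>S - {x}. [:- y, 1:])" for x :: real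
  define d where "d x = (\<Prod>y\<in>S - {x}. x - y)" for x
  define q where "q = (\<Sum>x\<in>S. smult (poly p x / d x) (B x)) - p"
  have deg_B: "degree (B x) = card S - 1 \<and> lead_coeff (B x) = 1" if "x \<in> S" for x
  proof -
    have "degree (B x) = (\<Sum>y\<in>S - {x}. degree [:- y, 1:])"
      unfolding B_def by (rule degree_prod_eq_sum_degree) simp
    moreover have "lead_coeff (B x) = 1"
      unfolding B_def lead_coeff_prod by simp
    ultimately show ?thesis using S that by simp
  qed
  have d: "d x \<noteq> 0" if "x \<in> S" for x using S by (simp add: d_def)
  have "poly q z = 0" if "z \<in> S" for z
  proof -
    have "poly (B x) z = (if x = z then d z else 0)" if "x \<in> S" for x
      using S \<open>z \<in> S\<close> by (auto simp: B_def d_def poly_prod)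
    then have "(\<Sum>x\<in>S. poly p x / d x * poly (B x) z) = (\<Sum>x\<in>S. if x = z then poly p z else 0)"
      using d by (intro sum.cong) auto
    then show ?thesis using S that by (simp add: q_def poly_sum)
  qed
  moreover have "degree q \<le> card S - 1"
    unfolding q_def using deg_B p S
    by (intro degree_diff_le degree_sum_le) (auto intro: order.trans[OF degree_smult_le])
  ultimately have "q = 0"
    using S p by (intro poly_eqI_degree[of S q 0]) auto
  then have "0 = coeff q (card S - 1)" by simp
  also have "\<dots> = (\<Sum>x\<in>S. poly p x / d x)"
  proof -
    have "coeff (B x) (card S - 1) = 1" if "x \<in> S" for x using deg_B[OF that] by metis
    moreover have "coeff p (card S - 1) = 0" using p by (intro coeff_eq_0) auto
    ultimately show ?thesis by (simp add: q_def coeff_sum)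
  qed
  finally show ?thesis by (simp add: d_def)
qed

text \<open>
  The squares imitate extremal points of a Chebyshev polynomial. The extra nodes 1 and 100 make the
  mass of the signed measure \<open>dual\<close> concentrate on 0 and 1 and decay like the inverse square of the node.
\<close>

definition gnode :: "nat \<Rightarrow> real" where
  "gnode i = 1000000 * real i ^ 2"

definition nodes :: "nat \<Rightarrow> real set" where
  "nodes n = {0, 1, 100} \<union> gnode ` {1..n}"

text \<open>A divided difference over the nodes, scaled to mass 1 at 0. With n + 3 nodes it
  annihilates all polynomials of degree at most n + 1, so its positive and negative parts have equal
  moments up to that order.\<close>

definition dual :: "nat \<Rightarrow> real \<Rightarrow> real" where
  "dual n x = (\<Prod>y\<in>nodes n - {0}. - y) / (\<Prod>y\<in>nodes n - {x}. x - y)"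

lemma gnode_ge: "1 \<le> i \<Longrightarrow> 1000000 \<le> gnode i"
  by (simp add: gnode_def)

lemma inj_gnode: "inj_on gnode A"
  by (auto simp: gnode_def inj_on_def)

lemma finite_nodes [simp]: "finite (nodes n)"
  by (simp add: nodes_def)

lemma nodes_disjoint: "{0, 1, 100} \<inter> gnode ` {1..n} = {}"
  using gnode_ge by fastforce

lemma card_nodes: "card (nodes n) = n + 3"
  unfolding nodes_def
  by (subst card_Un_disjoint) (use nodes_disjoint in \<open>auto simp: card_image inj_gnode\<close>)

lemma nodes_bounds: "x \<in> nodes n \<Longrightarrow> 1 \<le> n \<Longrightarrow> 0 \<le> x \<and> x \<le> gnode n"
  using gnode_ge[of n] by (auto simp: nodes_def) (auto simp: gnode_def intro: power_mono)

lemma dual_0 [simp]: "dual n 0 = 1"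
  by (simp add: dual_def prod_zero_iff)

lemma dual_moments:
  assumes "j \<le> n + 1"
  shows "(\<Sum>x\<in>nodes n. dual n x * x ^ j) = 0"
proof -
  have "(\<Sum>x\<in>nodes n. x ^ j / (\<Prod>y\<in>nodes n - {x}. x - y)) = 0"
    using sum_divided_difference_eq_0[of "nodes n" "monom 1 j"] assms
    by (simp add: card_nodes degree_monom_eq poly_monom)
  then have "(\<Prod>y\<in>nodes n - {0}. - y) * (\<Sum>x\<in>nodes n. x ^ j / (\<Prod>y\<in>nodes n - {x}. x - y)) = 0"
    by simp
  then show ?thesis
    by (simp add: dual_def sum_distrib_left)
qed

lemma prod_nodes:
  fixes F :: "real \<Rightarrow> real"
  shows "(\<Prod>y\<in>nodes n. F y) = F 0 * F 1 * F 100 * (\<Prod>i=1..n. F (gnode i))"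
  unfolding nodes_def
  by (subst prod.union_disjoint) (use nodes_disjoint in \<open>auto simp: prod.reindex inj_gnode\<close>)

lemma sum_nodes:
  fixes F :: "real \<Rightarrow> real"
  shows "(\<Sum>y\<in>nodes n. F y) = F 0 + F 1 + F 100 + (\<Sum>i=1..n. F (gnode i))"
  unfolding nodes_def
  by (subst sum.union_disjoint) (use nodes_disjoint in \<open>auto simp: sum.reindex inj_gnode\<close>)

text \<open>Factors 1 bring both products to the index set \<open>nodes n\<close>, so that
  \<open>prod_nodes\<close> splits the quotient node by node.\<close>

lemma dual_eq:
  assumes "x \<in> nodes n"
  shows "dual n x = (\<Prod>y\<in>nodes n. (if y = 0 then 1 else - y) / (if y = x then 1 else x - y))"
proof -
  have "(\<Prod>y\<in>nodes n - {0}. - y) = (\<Prod>y\<in>nodes n. if y = 0 then 1 else - y)"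
    by (rule prod.mono_neutral_cong_left) auto
  moreover have "(\<Prod>y\<in>nodes n - {x}. x - y) = (\<Prod>y\<in>nodes n. if y = x then 1 else x - y)"
    by (rule prod.mono_neutral_cong_left) auto
  ultimately show ?thesis by (simp add: dual_def prod_dividef)
qed

text \<open>The factor -1 of node 1 itself is the only negative one, since -y / (1 - y) > 0 for y >
  1. So the positive part has no mass at 1, and only 100 and the far nodes matter for its
  sparsity.\<close>

lemma dual_1_nonpos: "dual n 1 \<le> 0"
proof -
  have "0 \<le> (\<Prod>i=1..n. - gnode i / (if gnode i = 1 then 1 else 1 - gnode i))"
  proof (rule prod_nonneg)
    fix i assume "i \<in> {1..n}"
    then show "0 \<le> - gnode i / (if gnode i = 1 then 1 else 1 - gnode i)"
      using gnode_ge[of i] by (auto simp: divide_le_0_iff)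
  qed
  moreover have "(\<Prod>i=1..n. (if gnode i = 0 then 1 else - gnode i) / (if gnode i = 1 then 1 else 1 - gnode i)) =
      (\<Prod>i=1..n. - gnode i / (if gnode i = 1 then 1 else 1 - gnode i))"
    using gnode_ge by (intro prod.cong) fastforce+
  ultimately show ?thesis
    by (subst dual_eq) (simp add: nodes_def, simp add: prod_nodes)
qed

lemma sum_inverse_squares_le: "(\<Sum>i=1..n. 1 / real i ^ 2) \<le> 2"
proof -
  have "(\<Sum>i=1..n. 1 / real i ^ 2) \<le> 2 - 1 / real n" if "1 \<le> n"
    using that
  proof (induction n rule: nat_induct_at_least)
    case (Suc n)
    have "1 / real (Suc n) ^ 2 \<le> 1 / real n - 1 / real (Suc n)"
      using Suc(1) by (simp add: divide_simps power2_eq_square)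
    then show ?case using Suc by simp
  qed simp
  moreover have "2 - 1 / real n \<le> 2" by simp
  ultimately show ?thesis by (cases "n = 0") (simp, linarith)
qed

text \<open>Nodes 0, 1 and 100 alone give 1/99. The scale 1000000 of the other nodes keeps the sum
  of 100 / \<open>gnode i\<close> at most 2/10000, so they enlarge this by a factor of at most
  10000/9998.\<close>

lemma abs_dual_100: "\<bar>dual n 100\<bar> \<le> 103 / 10000"
proof -
  let ?p = "\<Prod>i=1..n. 1 - 100 / gnode i"
  have "1 - (\<Sum>i=1..n. 100 / gnode i) \<le> ?p"
  proof (rule Weierstrass_prod_ineq)
    show "100 / gnode i \<in> {0..1}" if "i \<in> {1..n}" for i
      using gnode_ge[of i] that by auto
  qed
  moreover have "(\<Sum>i=1..n. 100 / gnode i) = 1 / 10000 * (\<Sum>i=1..n. 1 / real i ^ 2)"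
    unfolding sum_distrib_left by (rule sum.cong) (auto simp: gnode_def)
  ultimately have p: "9998 / 10000 \<le> ?p"
    using sum_inverse_squares_le[of n] by simp
  have "\<bar>dual n 100\<bar> = 1 / 99 *
      (\<Prod>i=1..n. \<bar>(if gnode i = 0 then 1 else - gnode i) / (if gnode i = 100 then 1 else 100 - gnode i)\<bar>)"
    by (subst dual_eq) (simp add: nodes_def, simp add: prod_nodes abs_mult abs_prod)
  also have "(\<Prod>i=1..n. \<bar>(if gnode i = 0 then 1 else - gnode i) / (if gnode i = 100 then 1 else 100 - gnode i)\<bar>) =
      (\<Prod>i=1..n. 1 / (1 - 100 / gnode i))"
  proof (rule prod.cong)
    fix i assume "i \<in> {1..n}"
    then have "1000000 \<le> gnode i" using gnode_ge by simp
    then show "\<bar>(if gnode i = 0 then 1 else - gnode i) / (if gnode i = 100 then 1 else 100 - gnode i)\<bar> =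
        1 / (1 - 100 / gnode i)"
      by (auto simp: divide_simps)
  qed simp
  also have "\<dots> = 1 / ?p" by (simp add: prod_dividef)
  also have "1 / 99 * (1 / ?p) \<le> 1 / 99 * (1 / (9998 / 10000))"
    using p by (intro mult_left_mono divide_left_mono) auto
  finally show ?thesis by simp
qed

text \<open>Writing i^2 - j^2 = (i - j)(i + j) turns the product into factorials; the 2 stems from
  the missing factor i + i at j = i.\<close>

lemma prod_square_ratio:
  assumes "1 \<le> i" "i \<le> n"
  shows "(\<Prod>j\<in>{1..n} - {i}. real j ^ 2 / \<bar>real i ^ 2 - real j ^ 2\<bar>) * (fact (n - i) * fact (n + i))
       = 2 * (fact n)\<^sup>2"
  using assms(2)
proof (induction n rule: dec_induct)
  case base
  \<comment> \<open>For n = i the product runs over j < i; it is built up one factor at a time, with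
    k as its upper end.\<close>
  have below: "(\<Prod>j=1..k. real j ^ 2 / \<bar>real i ^ 2 - real j ^ 2\<bar>) * (fact (i - 1) * fact (i + k)) =
      (fact k)\<^sup>2 * fact (i - 1 - k) * fact i" if "k < i" for k
    using that
  proof (induction k)
    case (Suc k)
    have 1: "real i ^ 2 - real (Suc k) ^ 2 = (real i - real (Suc k)) * (real i + real (Suc k))"
      by (simp add: power2_eq_square algebra_simps)
    have 2: "i - 1 - k = Suc (i - 1 - Suc k)" using Suc by simp
    have 3: "(fact (i - 1 - k) :: real) = (real i - real (Suc k)) * fact (i - 1 - Suc k)"
      unfolding 2 fact_Suc using Suc by (simp add: of_nat_diff)
    have pos: "0 < real i - real (Suc k)" "0 < real i + real (Suc k)" using Suc by auto
    have 4: "(fact (i + Suc k) :: real) = (real i + real (Suc k)) * fact (i + k)"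
      by (simp add: algebra_simps)
    have "(\<Prod>j=1..Suc k. real j ^ 2 / \<bar>real i ^ 2 - real j ^ 2\<bar>) * (fact (i - 1) * fact (i + Suc k))
        = real (Suc k) ^ 2 / (real i - real (Suc k)) *
          ((\<Prod>j=1..k. real j ^ 2 / \<bar>real i ^ 2 - real j ^ 2\<bar>) * (fact (i - 1) * fact (i + k)))"
    proof -
      have gen: "A * (c / (r * s)) * (f * (s * h)) = c / r * (A * (f * h))" if "s \<noteq> 0" for A c r s f h :: real
        using that by simp
      have "\<bar>real i ^ 2 - real (Suc k) ^ 2\<bar> = (real i - real (Suc k)) * (real i + real (Suc k))"
        unfolding 1 abs_mult using pos by simp
      then show ?thesis
        unfolding 4 by (subst prod.nat_ivl_Suc') (use pos(2) in \<open>auto simp: gen mult.commute[of "real (Suc k) ^ 2 / _"] simp del: of_nat_Suc\<close>)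
    qed
    also have "\<dots> = real (Suc k) ^ 2 / (real i - real (Suc k)) * ((fact k)\<^sup>2 * fact (i - 1 - k) * fact i)"
      using Suc by simp
    also have "\<dots> = (fact (Suc k))\<^sup>2 * fact (i - 1 - Suc k) * fact i"
      unfolding 3 using pos(1) by (simp add: power_mult_distrib)
    finally show ?case .
  qed simp
  have "{1..i} - {i} = {1..i - 1}" using assms(1) by auto
  moreover have "(fact (i + i) :: real) = 2 * real i * fact (i + (i - 1))" "(fact i :: real) = real i * fact (i - 1)"
    using assms(1) by (cases i; simp)+
  ultimately show ?case using below[of "i - 1"] assms(1)
    by (simp add: power2_eq_square mult_ac)
next
  case (step n)
  have "{1..Suc n} - {i} = insert (Suc n) ({1..n} - {i})" using step by auto
  moreover have "\<bar>real i ^ 2 - real (Suc n) ^ 2\<bar> = (real (Suc n) - real i) * (real (Suc n) + real i)"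
  proof -
    have "real i ^ 2 - real (Suc n) ^ 2 = - ((real (Suc n) - real i) * (real (Suc n) + real i))"
      by (simp add: power2_eq_square algebra_simps)
    then show ?thesis using step by (simp add: abs_mult)
  qed
  moreover have "(fact (Suc n - i) :: real) = (real (Suc n) - real i) * fact (n - i)"
    using step by (simp add: Suc_diff_le)
  moreover have "(fact (Suc n + i) :: real) = (real (Suc n) + real i) * fact (n + i)"
    by simp
  moreover have "real (Suc n) - real i > 0" "real (Suc n) + real i > 0" using step by auto
  moreover have "c / (r * s) * A * ((r * f) * (s * h)) = c * (A * (f * h))" if "0 < r" "0 < s"
    for A c r s f h :: real
    using that by simp
  moreover have "(fact (Suc n) :: real) = real (Suc n) * fact n" by simp
  ultimately show ?case using step.IH
    by (simp add: power_mult_distrib del: of_nat_Suc fact_Suc add_Suc)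
qed

text \<open>Raising i by one replaces a factor n - i by the larger factor n + i + 1.\<close>

lemma fact_square_le: "i \<le> n \<Longrightarrow> (fact n)\<^sup>2 \<le> (fact (n - i) * fact (n + i) :: real)"
proof (induction i)
  case (Suc i)
  have "n - i = Suc (n - Suc i)" using Suc by simp
  then have 1: "(fact (n - i) :: real) = real (n - i) * fact (n - Suc i)" by (simp only: fact_Suc)
  have "(fact n)\<^sup>2 \<le> (fact (n - i) * fact (n + i) :: real)" using Suc by simp
  also have "\<dots> \<le> real (n + Suc i) * (fact (n - Suc i) * fact (n + i))"
    unfolding 1 by (simp add: mult_right_mono mult.assoc)
  finally show ?case by (simp add: mult_ac)
qed (simp add: power2_eq_square)

text \<open>For the node g, the factors of 0, 1, 100 and g itself give 100 / ((g - 1)(g - 100)), and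
  the remaining squares at most 2 by \<open>prod_square_ratio\<close>; 201 instead of 200 absorbs
  the shifts. The extra factor g is for the mean: it leaves order 1/i^2, whose sum is bounded
  independently of n.\<close>

lemma abs_dual_gnode:
  assumes "1 \<le> i" "i \<le> n"
  shows "gnode i * \<bar>dual n (gnode i)\<bar> \<le> 201 / gnode i"
proof -
  let ?g = "gnode i"
  let ?R = "\<Prod>j\<in>{1..n} - {i}. real j ^ 2 / \<bar>real i ^ 2 - real j ^ 2\<bar>"
  have g: "1000000 \<le> ?g" using gnode_ge assms by simp
  have "\<bar>dual n ?g\<bar> = 1 / ?g * (1 / (?g - 1)) * (100 / (?g - 100)) *
      (\<Prod>j=1..n. \<bar>(if gnode j = 0 then 1 else - gnode j) / (if gnode j = ?g then 1 else ?g - gnode j)\<bar>)"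
    using assms g by (subst dual_eq) (simp add: nodes_def, simp add: prod_nodes abs_mult abs_prod)
  also have "(\<Prod>j=1..n. \<bar>(if gnode j = 0 then 1 else - gnode j) / (if gnode j = ?g then 1 else ?g - gnode j)\<bar>) =
      ?g * (\<Prod>j\<in>{1..n} - {i}. \<bar>(if gnode j = 0 then 1 else - gnode j) / (if gnode j = ?g then 1 else ?g - gnode j)\<bar>)"
    using assms g by (subst prod.remove[of _ i]) auto
  also have "(\<Prod>j\<in>{1..n} - {i}. \<bar>(if gnode j = 0 then 1 else - gnode j) / (if gnode j = ?g then 1 else ?g - gnode j)\<bar>) = ?R"
  proof (rule prod.cong)
    fix j assume j: "j \<in> {1..n} - {i}"
    then have "gnode j \<noteq> 0" "gnode j \<noteq> ?g"
      using gnode_ge[of j] inj_gnode[of UNIV] by (auto dest: injD)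
    moreover have "\<bar>- gnode j / (?g - gnode j)\<bar> = real j ^ 2 / \<bar>real i ^ 2 - real j ^ 2\<bar>"
    proof -
      have "\<bar>- (k * b) / (k * a - k * b)\<bar> = b / \<bar>a - b\<bar>" if "k \<noteq> 0" "0 \<le> b" for a b k :: real
        using that unfolding right_diff_distrib[symmetric] by (simp add: abs_mult)
      from this[of 1000000 "real j ^ 2" "real i ^ 2"] show ?thesis by (simp add: gnode_def)
    qed
    ultimately show "\<bar>(if gnode j = 0 then 1 else - gnode j) / (if gnode j = ?g then 1 else ?g - gnode j)\<bar> =
        real j ^ 2 / \<bar>real i ^ 2 - real j ^ 2\<bar>"
      by simp
  qed simp
  also have "1 / ?g * (1 / (?g - 1)) * (100 / (?g - 100)) * (?g * ?R) = 100 / ((?g - 1) * (?g - 100)) * ?R"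
    using g by simp
  also have "\<dots> \<le> 100 / ((?g - 1) * (?g - 100)) * 2"
  proof (rule mult_left_mono)
    let ?f = "fact (n - i) * fact (n + i) :: real"
    have "?R * ?f \<le> 2 * ?f" using prod_square_ratio[OF assms] fact_square_le[OF assms(2)] by simp
    moreover have "0 < ?f" by simp
    ultimately show "?R \<le> 2" by (rule mult_right_le_imp_le)
  qed (use g in auto)
  finally have "?g * \<bar>dual n ?g\<bar> \<le> ?g * (200 / ((?g - 1) * (?g - 100)))"
    using g by (intro mult_left_mono) auto
  also have "\<dots> \<le> 201 / ?g"
  proof -
    have "200 * (?g * ?g) \<le> 201 * ((?g - 1) * (?g - 100))"
    proof -
      have "201 * ((?g - 1) * (?g - 100)) - 200 * (?g * ?g) = ?g * (?g - 20301) + 20100"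
        by (simp add: algebra_simps)
      moreover have "0 \<le> ?g * (?g - 20301)" using g by simp
      ultimately show ?thesis by linarith
    qed
    then show ?thesis using g by (simp add: field_simps)
  qed
  finally show ?thesis .
qed

lemma dual_tail:
  shows "(\<Sum>i=1..n. gnode i * \<bar>dual n (gnode i)\<bar>) \<le> 1 / 1000"
    and "(\<Sum>i=1..n. \<bar>dual n (gnode i)\<bar>) \<le> 1 / 1000"
proof -
  have "(\<Sum>i=1..n. gnode i * \<bar>dual n (gnode i)\<bar>) \<le> (\<Sum>i=1..n. 201 / 1000000 * (1 / real i ^ 2))"
    using abs_dual_gnode by (intro sum_mono) (fastforce simp: gnode_def)
  also have "\<dots> \<le> 201 / 1000000 * 2"
    unfolding sum_distrib_left[symmetric] using sum_inverse_squares_le by (intro mult_left_mono) auto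
  finally show *: "(\<Sum>i=1..n. gnode i * \<bar>dual n (gnode i)\<bar>) \<le> 1 / 1000" by simp
  have "(\<Sum>i=1..n. \<bar>dual n (gnode i)\<bar>) \<le> (\<Sum>i=1..n. gnode i * \<bar>dual n (gnode i)\<bar>)"
  proof (rule sum_mono)
    fix i assume "i \<in> {1..n}"
    then show "\<bar>dual n (gnode i)\<bar> \<le> gnode i * \<bar>dual n (gnode i)\<bar>"
      using gnode_ge[of i] mult_right_mono[of 1 "gnode i" "\<bar>dual n (gnode i)\<bar>"] by simp
  qed
  with * show "(\<Sum>i=1..n. \<bar>dual n (gnode i)\<bar>) \<le> 1 / 1000" by linarith
qed

text \<open>The positive and negative parts of \<open>dual\<close> are divided by their common mass
  Z, which is at least 1 because of the node 0. Sparsity: 103/10000 + 1/1000 < 1/80. Mean before the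
  division: node 1 adds at most Z, node 100 at most 1.03, the tail at most 1/1000.\<close>

lemma moment_matching_pair:
  obtains P Q :: "real \<Rightarrow> real" where
    "\<And>x. 0 \<le> P x" "\<And>x. 0 \<le> Q x" "(\<Sum>x\<in>nodes n. P x) = 1" "(\<Sum>x\<in>nodes n. Q x) = 1"
    "\<And>j. j \<le> n + 1 \<Longrightarrow> (\<Sum>x\<in>nodes n. P x * x ^ j) = (\<Sum>x\<in>nodes n. Q x * x ^ j)"
    "Q 0 = 0" "(\<Sum>x\<in>nodes n. P x * of_bool (x \<noteq> 0)) \<le> 1 / 80" "(\<Sum>x\<in>nodes n. Q x * x) \<le> 3"
proof -
  define p where "p x = max (dual n x) 0" for x
  define q where "q x = max (- dual n x) 0" for x
  define Z where "Z = (\<Sum>x\<in>nodes n. p x)"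
  have pq: "dual n x = p x - q x" "0 \<le> p x" "0 \<le> q x" "p x \<le> \<bar>dual n x\<bar>" "q x \<le> \<bar>dual n x\<bar>" for x
    by (auto simp: p_def q_def)
  have mom: "(\<Sum>x\<in>nodes n. p x * x ^ j) = (\<Sum>x\<in>nodes n. q x * x ^ j)" if "j \<le> n + 1" for j
    using dual_moments[OF that] by (simp add: pq(1) algebra_simps sum_subtractf)
  have Zq: "Z = (\<Sum>x\<in>nodes n. q x)" using mom[of 0] by (simp add: Z_def)
  have "p 0 \<le> Z" unfolding Z_def using pq by (intro member_le_sum) (auto simp: nodes_def)
  then have Z: "1 \<le> Z" by (simp add: p_def)
  have q1: "q 1 \<le> Z" unfolding Zq using pq by (intro member_le_sum) (auto simp: nodes_def)
  have "p 1 = 0" using dual_1_nonpos[of n] by (simp add: p_def)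
  have "(\<Sum>x\<in>nodes n. p x * of_bool (x \<noteq> 0)) \<le> p 100 + (\<Sum>i=1..n. p (gnode i))"
    unfolding sum_nodes using pq(2) \<open>p 1 = 0\<close> by (auto simp del: sum_mult_of_bool_eq intro!: add_mono sum_mono)
  also have "\<dots> \<le> 103 / 10000 + (\<Sum>i=1..n. \<bar>dual n (gnode i)\<bar>)"
    using pq(4) abs_dual_100[of n] by (intro add_mono sum_mono order.trans[OF pq(4)]) auto
  finally have P0: "(\<Sum>x\<in>nodes n. p x * of_bool (x \<noteq> 0)) \<le> 1 / 80 * Z"
    using dual_tail(2)[of n] Z by linarith
  have "(\<Sum>x\<in>nodes n. q x * x) = q 1 + 100 * q 100 + (\<Sum>i=1..n. gnode i * q (gnode i))"
    unfolding sum_nodes by (simp add: mult.commute)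
  also have "\<dots> \<le> Z + 100 * (103 / 10000) + (\<Sum>i=1..n. gnode i * \<bar>dual n (gnode i)\<bar>)"
    using order.trans[OF pq(5) abs_dual_100[of n]] q1
    by (intro add_mono sum_mono mult_left_mono pq(5)) (auto simp: gnode_def)
  finally have Q1: "(\<Sum>x\<in>nodes n. q x * x) \<le> 3 * Z"
    using dual_tail(1)[of n] Z by linarith
  have scale: "(\<Sum>x\<in>nodes n. r x / Z * F x) = (\<Sum>x\<in>nodes n. r x * F x) / Z" for r F
    by (simp add: sum_divide_distrib)
  show thesis
  proof (rule that[of "\<lambda>x. p x / Z" "\<lambda>x. q x / Z"])
    show "(\<Sum>x\<in>nodes n. p x / Z) = 1" "(\<Sum>x\<in>nodes n. q x / Z) = 1"
      using Z by (simp_all add: sum_divide_distrib[symmetric] Zq[symmetric]) (simp add: Z_def)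
    show "q 0 / Z = 0" by (simp add: q_def)
    show "(\<Sum>x\<in>nodes n. p x / Z * of_bool (x \<noteq> 0)) \<le> 1 / 80"
      unfolding scale using P0 Z by (simp add: field_simps)
    show "(\<Sum>x\<in>nodes n. q x / Z * x) \<le> 3"
      unfolding scale using Q1 Z by (simp add: field_simps)
    show "(\<Sum>x\<in>nodes n. p x / Z * x ^ j) = (\<Sum>x\<in>nodes n. q x / Z * x ^ j)" if "j \<le> n + 1" for j
      unfolding scale using mom[OF that] by simp
  qed (use pq Z in auto)
qed

section \<open>Testers and finitely supported distributions\<close>

definition inner_measure :: "'a measure \<Rightarrow> 'a set \<Rightarrow> real" where
  "inner_measure R A = (SUP B\<in>{B \<in> sets R. B \<subseteq> A}. measure R B)"

context prob_space
begin

lemma le_inner: "B \<in> events \<Longrightarrow> B \<subseteq> A \<Longrightarrow> prob B \<le> inner_measure M A"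
  unfolding inner_measure_def by (rule cSUP_upper) (auto intro!: bdd_aboveI[of _ 1])

lemma inner_nonneg: "0 \<le> inner_measure M A"
  using le_inner[of "{}" A] by simp

text \<open>Superadditivity survives for non-measurable sets; it makes the acceptance and rejection
  weights of a sample add up to at most 1.\<close>

lemma inner_add_le:
  assumes "A \<inter> B = {}"
  shows "inner_measure M A + inner_measure M B \<le> 1"
proof -
  have ne: "{B \<in> events. B \<subseteq> C} \<noteq> {}" for C by auto
  have *: "prob A' + prob B' \<le> 1" if "A' \<in> events" "A' \<subseteq> A" "B' \<in> events" "B' \<subseteq> B" for A' B'
  proof -
    have "A' \<inter> B' = {}" using that assms by blast
    then show ?thesis using finite_measure_Union[of A' B'] that prob_le_1[of "A' \<union> B'"] by simp
  qed
  have "prob A' \<le> 1 - inner_measure M B" if "A' \<in> events" "A' \<subseteq> A" for A'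
  proof -
    have "inner_measure M B \<le> 1 - prob A'"
      unfolding inner_measure_def using *[OF that] by (intro cSUP_least ne) (simp add: le_diff_eq add.commute)
    then show ?thesis by simp
  qed
  then have "inner_measure M A \<le> 1 - inner_measure M B"
    unfolding inner_measure_def[of M A] by (intro cSUP_least ne) auto
  then show ?thesis by simp
qed

end

section \<open>Finitely supported distributions and their samples\<close>

definition atomic :: "'a measure \<Rightarrow> (nat \<Rightarrow> 'a) \<Rightarrow> nat \<Rightarrow> (nat \<Rightarrow> real) \<Rightarrow> 'a measure" where
  "atomic S g M w = distr (point_measure {..<M} (\<lambda>i. ennreal (w i / sum w {..<M}))) S g"

definition draws :: "(nat \<Rightarrow> 'a) \<Rightarrow> nat list \<Rightarrow> nat \<Rightarrow> 'a" where
  "draws g l = (\<lambda>i\<in>{..<length l}. g (l ! i))"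

lemma draws_snoc: "draws g (l @ [i]) = (draws g l)(length l := g i)"
  by (rule ext) (auto simp: draws_def nth_append restrict_def)

text \<open>Integrals over samples are computed in \<open>ennreal\<close>, estimates in
  \<open>real\<close>; \<open>wsum\<close> is defined over a commutative semiring to serve
  both.\<close>

lemma wsum_ennreal:
  assumes "\<And>i. i \<in> Z \<Longrightarrow> 0 \<le> v i" "\<And>l. 0 \<le> \<phi> l"
  shows "wsum (\<lambda>i. ennreal (v i)) Z m (\<lambda>l. ennreal (\<phi> l)) = ennreal (wsum v Z m \<phi>)"
proof -
  have *: "prod_list (map (\<lambda>i. ennreal (v i)) l) = ennreal (prod_list (map v l)) \<and> 0 \<le> prod_list (map v l)"
    if "set l \<subseteq> Z" for l
    using that assms(1) by (induction l) (auto simp: ennreal_mult)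
  have "wsum (\<lambda>i. ennreal (v i)) Z m (\<lambda>l. ennreal (\<phi> l)) =
      (\<Sum>l | set l \<subseteq> Z \<and> length l = m. ennreal (prod_list (map v l) * \<phi> l))"
    unfolding wsum_def using * assms by (intro sum.cong) (auto simp: ennreal_mult)
  also have "\<dots> = ennreal (wsum v Z m \<phi>)"
    unfolding wsum_def by (rule sum_ennreal) (use * assms in auto)
  finally show ?thesis .
qed

locale atoms =
  fixes S :: "'a measure" and g :: "nat \<Rightarrow> 'a" and M :: nat and w :: "nat \<Rightarrow> real"
  assumes g_space: "\<And>i. i < M \<Longrightarrow> g i \<in> space S"
    and g_sets: "\<And>i. i < M \<Longrightarrow> {g i} \<in> sets S"
    and w_nonneg: "\<And>i. i < M \<Longrightarrow> 0 \<le> w i"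
    and w_pos: "0 < sum w {..<M}"
begin

abbreviation "dst \<equiv> atomic S g M w"
abbreviation "p \<equiv> \<lambda>i. w i / sum w {..<M}"

lemma p_nonneg: "i < M \<Longrightarrow> 0 \<le> p i"
  using w_nonneg w_pos by simp

lemma sum_p: "sum p {..<M} = 1"
  using w_pos by (simp add: sum_divide_distrib[symmetric])

lemma sets_D [measurable_cong, simp]: "sets dst = sets S"
  by (simp add: atomic_def)

lemma space_D [simp]: "space dst = space S"
  by (simp add: atomic_def)

lemma nn_integral_D:
  assumes "f \<in> borel_measurable S"
  shows "(\<integral>\<^sup>+x. f x \<partial>dst) = (\<Sum>i<M. ennreal (p i) * f (g i))"
proof -
  have "g \<in> point_measure {..<M} (\<lambda>i. ennreal (p i)) \<rightarrow>\<^sub>M S"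
    using g_space by (auto simp: measurable_def space_point_measure sets_point_measure)
  then show ?thesis
    unfolding atomic_def using assms by (simp add: nn_integral_distr nn_integral_point_measure_finite)
qed

lemma emeasure_D:
  assumes "A \<in> sets S"
  shows "emeasure dst A = ennreal (\<Sum>i<M. p i * of_bool (g i \<in> A))"
proof -
  have "emeasure dst A = (\<integral>\<^sup>+x. indicator A x \<partial>dst)" using assms by simp
  also have "\<dots> = (\<Sum>i<M. ennreal (p i) * indicator A (g i))"
    using assms by (intro nn_integral_D) simp
  also have "\<dots> = (\<Sum>i<M. ennreal (p i * of_bool (g i \<in> A)))"
    by (intro sum.cong) (auto simp: indicator_def)
  also have "\<dots> = ennreal (\<Sum>i<M. p i * of_bool (g i \<in> A))"
  proof (rule sum_ennreal)
    fix i assume "i \<in> {..<M}"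
    then show "0 \<le> p i * of_bool (g i \<in> A)" using p_nonneg[of i] by (cases "g i \<in> A") auto
  qed
  finally show ?thesis .
qed

sublocale prob_space dst
proof
  have "(\<Sum>i<M. p i * of_bool (g i \<in> space S)) = sum p {..<M}"
    using g_space by (intro sum.cong) auto
  then show "emeasure dst (space dst) = 1" by (simp add: emeasure_D sum_p del: sum_mult_of_bool_eq)
qed

text \<open>Off the finitely many atoms the distribution is null, so any set of points differs by a
  null part from a finite measurable one. This makes every two-valued function an admissible
  instance.\<close>

lemma completion_D:
  assumes "A \<subseteq> space S"
  shows "A \<in> sets (completion dst)"
    and "measure (completion dst) A = (\<Sum>i<M. p i * of_bool (g i \<in> A))"
proof -
  let ?F = "g ` {..<M}"
  let ?B = "A \<inter> ?F"
  have fin: "C \<subseteq> ?F \<Longrightarrow> C \<in> sets S" for C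
  proof -
    assume C: "C \<subseteq> ?F"
    then have "finite C" by (rule finite_subset) simp
    then have "(\<Union>x\<in>C. {x}) \<in> sets S" using C g_sets by (intro sets.finite_UN) auto
    then show "C \<in> sets S" by simp
  qed
  have "space S - ?F \<in> sets S" using fin[of ?F] by auto
  then have N: "space S - ?F \<in> null_sets dst"
    by (auto simp: null_sets_def emeasure_D intro!: sum.neutral)
  show A: "A \<in> sets (completion dst)"
    using assms by (intro sets_completionI[OF _ _ N, of A ?B "A - ?F"]) (auto intro: fin)
  have "AE x in completion dst. x \<in> A \<longleftrightarrow> x \<in> ?B"
    using AE_not_in[OF N] AE_space[of dst] by (intro AE_completion) (auto elim: AE_mp)
  then have "measure (completion dst) A = measure (completion dst) ?B"
    by (rule measure_eq_AE) (use A fin[of ?B] in auto)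
  also have "\<dots> = measure dst ?B" using fin[of ?B] by simp
  also have "\<dots> = (\<Sum>i<M. p i * of_bool (g i \<in> ?B))"
    unfolding measure_def using fin[of ?B] p_nonneg
    by (subst emeasure_D) (auto intro!: enn2real_ennreal sum_nonneg simp del: sum_mult_of_bool_eq)
  also have "\<dots> = (\<Sum>i<M. p i * of_bool (g i \<in> A))" by (intro sum.cong) auto
  finally show "measure (completion dst) A = (\<Sum>i<M. p i * of_bool (g i \<in> A))" .
qed

lemma instance_D: "f \<in> two_valued S \<Longrightarrow> (dst, f) \<in> instances S"
  unfolding instances_def distributions_def
  by (auto simp: prob_space_axioms completion_D(1) measurable_def)

lemma fun_dist_D: "fun_dist dst f h = (\<Sum>i<M. p i * of_bool (f (g i) \<noteq> h (g i)))"
  unfolding fun_dist_def using g_space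
  by (subst completion_D) (auto intro!: sum.cong simp del: sum_mult_of_bool_eq)

lemma nn_integral_samples:
  assumes "\<phi> \<in> borel_measurable (\<Pi>\<^sub>M i\<in>{..<m}. dst)"
  shows "(\<integral>\<^sup>+s. \<phi> s \<partial>(\<Pi>\<^sub>M i\<in>{..<m}. dst)) = wsum (\<lambda>i. ennreal (p i)) {..<M} m (\<lambda>l. \<phi> (draws g l))"
  using assms
proof (induction m arbitrary: \<phi>)
  case 0
  then show ?case
    by (simp add: PiM_empty nn_integral_count_space_finite draws_def restrict_def)
next
  case (Suc m)
  interpret P: product_sigma_finite "\<lambda>_. dst" by standard
  have ins: "{..<Suc m} = insert m {..<m}" by auto
  have \<phi>: "\<phi> \<in> borel_measurable (\<Pi>\<^sub>M i\<in>insert m {..<m}. dst)" using Suc.prems by (simp add: ins)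
  have upd: "(\<lambda>x. \<phi> (x(m := g i))) \<in> borel_measurable (\<Pi>\<^sub>M i\<in>{..<m}. dst)" if "i < M" for i
    using g_space[OF that]
    by (intro measurable_compose[OF _ \<phi>] measurable_fun_upd[where J = "{..<m}"]) auto
  have "(\<integral>\<^sup>+s. \<phi> s \<partial>(\<Pi>\<^sub>M i\<in>{..<Suc m}. dst)) =
      (\<integral>\<^sup>+x. (\<integral>\<^sup>+y. \<phi> (x(m := y)) \<partial>dst) \<partial>(\<Pi>\<^sub>M i\<in>{..<m}. dst))"
    unfolding ins using P.product_nn_integral_insert[OF _ _ \<phi>] by simp
  also have "\<dots> = (\<integral>\<^sup>+x. (\<Sum>i<M. ennreal (p i) * \<phi> (x(m := g i))) \<partial>(\<Pi>\<^sub>M i\<in>{..<m}. dst))"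
  proof (rule nn_integral_cong)
    fix x assume x: "x \<in> space (\<Pi>\<^sub>M i\<in>{..<m}. dst)"
    have "(\<lambda>y. \<phi> (x(m := y))) \<in> borel_measurable S"
      using x by (intro measurable_compose[OF _ \<phi>] measurable_fun_upd[where J = "{..<m}"]) auto
    then show "(\<integral>\<^sup>+y. \<phi> (x(m := y)) \<partial>dst) = (\<Sum>i<M. ennreal (p i) * \<phi> (x(m := g i)))"
      by (rule nn_integral_D)
  qed
  also have "\<dots> = (\<Sum>i<M. ennreal (p i) * (\<integral>\<^sup>+x. \<phi> (x(m := g i)) \<partial>(\<Pi>\<^sub>M i\<in>{..<m}. dst)))"
    using upd by (subst nn_integral_sum) (auto simp: nn_integral_cmult intro!: borel_measurable_times)
  also have "\<dots> = (\<Sum>i<M. ennreal (p i) * wsum (\<lambda>i. ennreal (p i)) {..<M} m (\<lambda>l. \<phi> (draws g (l @ [i]))))"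
    by (intro sum.cong refl arg_cong2[where f = "(*)"], subst Suc.IH[OF upd])
      (auto intro!: wsum_cong simp: draws_snoc)
  finally show ?case by (simp add: wsum_Suc_snoc)
qed

text \<open>
  The execution is measured in a completion, where the sections in the tester's randomness
  need not be measurable; hence the inner measure.
\<close>

lemma prob_exec_space_le:
  assumes "prob_space R"
  shows "\<P>((r, s) in exec_space R dst m. Ev r s)
      \<le> wsum p {..<M} m (\<lambda>l. inner_measure R {r \<in> space R. Ev r (draws g l)})"
proof -
  interpret R: prob_space R by fact
  let ?P = "\<Pi>\<^sub>M i\<in>{..<m}. dst"
  interpret P: prob_space ?P by (intro prob_space_PiM prob_space_axioms)
  interpret pair_sigma_finite R ?P ..
  let ?N = "R \<Otimes>\<^sub>M ?P"
  let ?E = "{(r, s). (r, s) \<in> space ?N \<and> Ev r s}"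
  have nonneg: "0 \<le> wsum p {..<M} m (\<lambda>l. inner_measure R {r \<in> space R. Ev r (draws g l)})"
    using p_nonneg R.inner_nonneg by (intro wsum_nonneg) auto
  show ?thesis
  proof (cases "?E \<in> sets (completion ?N)")
    case True
    \<comment> \<open>A measurable subset of the event with the same mass; its sections are
      measurable and lie in those of the event.\<close>
    let ?B = "main_part ?N ?E"
    have B: "?B \<in> sets ?N" "?B \<subseteq> ?E" using main_part_sets[OF True] main_part_null_part_Un[OF True] by auto
    have "emeasure (completion ?N) ?E = emeasure ?N ?B" using True by simp
    also have "\<dots> = (\<integral>\<^sup>+s. emeasure R ((\<lambda>r. (r, s)) -` ?B) \<partial>?P)"
      by (rule emeasure_pair_measure_alt2[OF B(1)])
    also have "\<dots> = wsum (\<lambda>i. ennreal (p i)) {..<M} m (\<lambda>l. emeasure R ((\<lambda>r. (r, draws g l)) -` ?B))"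
      by (intro nn_integral_samples measurable_emeasure_Pair2 B(1))
    also have "\<dots> = ennreal (wsum p {..<M} m (\<lambda>l. measure R ((\<lambda>r. (r, draws g l)) -` ?B)))"
      unfolding R.emeasure_eq_measure using p_nonneg by (intro wsum_ennreal) auto
    also have "\<dots> \<le> ennreal (wsum p {..<M} m (\<lambda>l. inner_measure R {r \<in> space R. Ev r (draws g l)}))"
      using p_nonneg B
      by (intro ennreal_leI wsum_mono R.le_inner sets_Pair2) (auto simp: space_pair_measure)
    finally show ?thesis
      unfolding exec_space_def space_completion measure_def using nonneg by (intro enn2real_leI)
  next
    \<comment> \<open>An event outside the completed sigma-algebra has \<open>measure\<close> 0 by
      convention.\<close>
    case False
    then show ?thesis using nonneg by (simp add: exec_space_def measure_notin_sets)
  qed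
qed

end

text \<open>With n of order ln M and about M n / 4 trials, overload is rare, and a dense trial is
  kept with probability at least 1 / \<open>gnode n\<close>, of order 1/n^2. The trials thus yield
  of order M / n samples, and a tester content with fewer could be simulated by them.\<close>

lemma sample_size_bound:
  assumes D: "2 \<le> D" "M = 4 * D"
    and ab: "\<And>l. 0 \<le> a l" "\<And>l. 0 \<le> b l" "\<And>l. a l + b l \<le> 1"
    and close: "\<And>w. (\<And>i. i < M \<Longrightarrow> 0 \<le> w i) \<Longrightarrow> 0 < sum w {..<M} \<Longrightarrow>
      card {i. i < M \<and> w i \<noteq> 0} \<le> D \<Longrightarrow>
      2 / 3 \<le> wsum (\<lambda>i. w i / sum w {..<M}) {..<M} m a"
    and far: "\<And>w. (\<And>i. i < M \<Longrightarrow> 1 \<le> w i) \<Longrightarrow> sum w {..<M} \<le> 60 * real M \<Longrightarrow>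
      2 / 3 \<le> wsum (\<lambda>i. w i / sum w {..<M}) {..<M} m b"
  shows "real D / (264000000 * ln (4 * real D)) \<le> real m"
proof -
  define x where "x = ln (real M)"
  \<comment> \<open>As 2^n is at least exp (2 n / 3), the overload bound is below M exp (n / 4 - 2 n
    / 3), and n >= 10 ln M makes this at most 1/M.\<close>
  define n where "n = nat \<lceil>10 * x\<rceil>"
  define T where "T = M * n div 4"
  have M: "8 \<le> M" using D by simp
  have x: "1 \<le> x"
  proof -
    have "exp 1 \<le> real M" using exp_le M by linarith
    then show ?thesis unfolding x_def using M by (subst ln_ge_iff) auto
  qed
  have n: "10 * x \<le> real n" "real n \<le> 10 * x + 1" "1 \<le> n"
    using x unfolding n_def by linarith+
  have nodes: "y \<in> nodes n \<Longrightarrow> 0 \<le> y \<and> y \<le> gnode n" "0 < gnode n"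
    "y \<in> nodes n \<Longrightarrow> y = 0 \<or> 1 \<le> y" for y
    using nodes_bounds[OF _ n(3)] gnode_ge[OF n(3)] gnode_ge by (auto simp: nodes_def) fastforce
  have overload: "real M * (1 + 1 / real M) ^ T / 2 ^ Suc (n + 1) \<le> 1 / 20"
  proof -
    have "(1 + 1 / real M) ^ T \<le> exp (1 / real M) ^ T"
      by (intro power_mono exp_ge_add_one_self) auto
    also have "\<dots> = exp (real T / real M)"
      by (simp add: exp_of_nat_mult[symmetric])
    also have "real T / real M \<le> real n / 4"
    proof -
      have "4 * T \<le> M * n" unfolding T_def by simp
      then have "4 * real T \<le> real M * real n" by (metis of_nat_le_iff of_nat_mult of_nat_numeral)
      then show ?thesis using M by (simp add: field_simps)
    qed
    finally have 1: "(1 + 1 / real M) ^ T \<le> exp (real n / 4)" by simp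
    have "exp (real n * (2 / 3)) \<le> exp (real n * ln 2)"
      using ln2_ge_two_thirds by (intro exp_le_cancel_iff[THEN iffD2] mult_left_mono) auto
    then have 2: "4 * exp (real n * (2 / 3)) \<le> 2 ^ Suc (n + 1)"
      by (simp add: exp_of_nat_mult)
    have "real M * (1 + 1 / real M) ^ T / 2 ^ Suc (n + 1) \<le> real M * exp (real n / 4) / (4 * exp (real n * (2 / 3)))"
      by (intro frac_le mult_mono 1 2) auto
    also have "\<dots> = real M / 4 * exp (real n / 4 - real n * (2 / 3))"
      unfolding exp_diff by simp
    also have "\<dots> \<le> real M / 4 * exp (- (2 * x))"
      using n(1) x by (intro mult_left_mono exp_le_cancel_iff[THEN iffD2]) auto
    also have "exp (- (2 * x)) = 1 / (real M * real M)"
    proof -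
      have "exp (- x) = 1 / real M" using M by (simp add: x_def exp_minus inverse_eq_divide)
      then show ?thesis using exp_add[of "- x" "- x"] by simp
    qed
    also have "real M / 4 * (1 / (real M * real M)) \<le> 1 / 20"
      using M by (simp add: field_simps)
    finally show ?thesis .
  qed
  obtain P Q :: "real \<Rightarrow> real" where
    "\<And>x. 0 \<le> P x" "\<And>x. 0 \<le> Q x" "(\<Sum>x\<in>nodes n. P x) = 1" "(\<Sum>x\<in>nodes n. Q x) = 1"
    "\<And>j. j \<le> n + 1 \<Longrightarrow> (\<Sum>x\<in>nodes n. P x * x ^ j) = (\<Sum>x\<in>nodes n. Q x * x ^ j)"
    "Q 0 = 0" "(\<Sum>x\<in>nodes n. P x * of_bool (x \<noteq> 0)) \<le> 1 / 80" "(\<Sum>x\<in>nodes n. Q x * x) \<le> 3"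
    by (rule moment_matching_pair[of n]) blast
  note PQ = this
  have "1 / 20 < 2 ^ m * (1 - 1 / (2 * gnode n)) ^ T"
    using D(1) by (intro support_size_indistinguishable[OF _ D(2) finite_nodes nodes PQ(1,3,2,4,5,7,6,8) ab close far overload]) simp
  also have "\<dots> \<le> exp (real m) * exp (- (real T / (2 * gnode n)))"
  proof (rule mult_mono)
    have "(2 :: real) \<le> exp 1" using exp_ge_add_one_self[of 1] by simp
    then have "(2 :: real) ^ m \<le> exp 1 ^ m" by (intro power_mono) auto
    then show "2 ^ m \<le> exp (real m)" by (simp add: exp_of_nat_mult[symmetric])
    have "1 - 1 / (2 * gnode n) \<le> exp (- (1 / (2 * gnode n)))"
      using exp_ge_add_one_self[of "- (1 / (2 * gnode n))"] by simp
    then have "(1 - 1 / (2 * gnode n)) ^ T \<le> exp (- (1 / (2 * gnode n))) ^ T"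
      using gnode_ge[OF n(3)] by (intro power_mono) (auto simp: field_simps)
    then show "(1 - 1 / (2 * gnode n)) ^ T \<le> exp (- (real T / (2 * gnode n)))"
      by (simp add: exp_of_nat_mult[symmetric])
    show "0 \<le> (1 - 1 / (2 * gnode n)) ^ T"
      using gnode_ge[OF n(3)] by (intro zero_le_power) (auto simp: field_simps)
  qed simp
  finally have E: "1 / 20 < exp (real m - real T / (2 * gnode n))"
    by (simp add: exp_diff exp_minus field_simps)
  have "- 5 < real m - real T / (2 * gnode n)"
  proof (rule ccontr)
    assume "\<not> ?thesis"
    then have "exp (real m - real T / (2 * gnode n)) \<le> exp (- 5)"
      by (intro exp_le_cancel_iff[THEN iffD2]) linarith
    moreover have "(2 :: real) ^ 5 \<le> exp 1 ^ 5"
      using exp_ge_add_one_self[of 1] by (intro power_mono) auto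
    then have "exp (- 5) \<le> 1 / (32 :: real)"
      by (simp add: exp_minus exp_of_nat_mult[symmetric] field_simps)
    ultimately show False using E by linarith
  qed
  then have T1: "real T < (real m + 5) * (2 * gnode n)"
    using nodes(2) by (simp add: field_simps)
  \<comment> \<open>Without samples, a point mass and equal weights would demand 2/3 from both
    \<open>a []\<close> and \<open>b []\<close>. From m >= 1, the additive 5 turns into the factor 6
    below.\<close>
  have "m \<noteq> 0"
  proof
    assume m: "m = 0"
    have "{i. i < M \<and> (if i = 0 then 1 else 0 :: real) \<noteq> 0} = {0}"
      using M by (auto split: if_splits)
    then have "card {i. i < M \<and> (if i = 0 then 1 else 0 :: real) \<noteq> 0} \<le> D"
      using D(1) by (simp only: card.insert card.empty) simp
    then have "2 / 3 \<le> a []"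
      using close[of "\<lambda>i. if i = 0 then 1 else 0"] M m by simp
    moreover have "2 / 3 \<le> b []" using far[of "\<lambda>_. 1"] m by simp
    ultimately show False using ab(3)[of "[]"] by simp
  qed
  then have "real m + 5 \<le> 6 * real m" by simp
  then have T2: "real T < 6 * real m * (2 * gnode n)"
    using T1 nodes(2) by (elim less_le_trans) (auto intro: mult_right_mono)
  \<comment> \<open>Rounding in \<open>T\<close> costs at most a factor 2, as M n is at least
    8.\<close>
  have "M * n \<le> 4 * T + 3" unfolding T_def by linarith
  moreover have "8 * 1 \<le> M * n" using M n(3) by (intro mult_le_mono) auto
  ultimately have "M * n \<le> 8 * T" by linarith
  then have "real M * real n \<le> 8 * real T" by (metis of_nat_le_iff of_nat_mult of_nat_numeral)
  also have "\<dots> \<le> 96000000 * real m * real n * real n"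
    using T2 by (simp add: gnode_def power2_eq_square)
  finally have "real M \<le> 96000000 * real m * real n" using n(3) by simp
  \<comment> \<open>From n <= 10 x + 1 <= 11 x; with M = 4 D the constant becomes 96000000 * 11 / 4
    = 264000000.\<close>
  also have "\<dots> \<le> 96000000 * real m * (11 * x)"
    using n(2) x by (intro mult_left_mono) auto
  finally have "real D \<le> real m * (264000000 * x)" using D by (simp add: mult_ac)
  then show ?thesis using x by (simp add: x_def D(2) divide_le_eq)
qed

section \<open>Alternating labels against a class with few sign changes\<close>

definition sign_pattern :: "'a measure \<Rightarrow> nat \<Rightarrow> (nat \<Rightarrow> 'a) \<Rightarrow> 'a \<Rightarrow> int" where
  "sign_pattern S D g = restrict (\<lambda>x. if x \<in> g ` {i. i < 4 * D \<and> odd i} then -1 else 1) (space S)"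

lemma sum_pairs: "(\<Sum>i<2 * n. F i) = (\<Sum>j<n. F (2 * j) + F (2 * j + 1))" for F :: "nat \<Rightarrow> real"
  by (induction n) (simp_all add: add.assoc)

text \<open>Drops from 1 to -1 are counted only within 2 D disjoint pairs. The alternating pattern
  drops in each of them, a member of the class in at most D, which forces an error in each of the at
  least D others.\<close>

locale alternating =
  fixes S :: "'a measure" and H :: "('a \<Rightarrow> int) set" and D :: nat and g :: "nat \<Rightarrow> 'a"
  assumes D: "2 \<le> D"
    and alt_inj: "inj_on g {..<4 * D}"
    and alt_space: "\<And>i. i < 4 * D \<Longrightarrow> g i \<in> space S"
    and alt_sets: "\<And>i. i < 4 * D \<Longrightarrow> {g i} \<in> sets S"
    and alt_two_valued: "H \<subseteq> two_valued S"
    and alt_shatter: "\<And>J. J \<subseteq> {..<4 * D} \<Longrightarrow> card J \<le> D \<Longrightarrow> \<exists>h\<in>H. \<forall>j\<in>J. h (g j) = (-1) ^ j"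
    and alt_changes: "\<And>h. h \<in> H \<Longrightarrow>
      card {j. j < 2 * D \<and> h (g (2 * j)) = 1 \<and> h (g (2 * j + 1)) = -1} \<le> D"
begin

abbreviation (input) "f \<equiv> sign_pattern S D g"
abbreviation (input) "M \<equiv> 4 * D"

lemma sign_pattern_g: "i < M \<Longrightarrow> f (g i) = (-1) ^ i"
proof -
  assume i: "i < M"
  have "g i \<in> g ` {i. i < M \<and> odd i} \<longleftrightarrow> i \<in> {i. i < M \<and> odd i}"
    by (rule inj_on_image_mem_iff[OF alt_inj]) (use i in auto)
  then show ?thesis using i alt_space[OF i] by (simp add: sign_pattern_def)
qed

lemma sign_pattern_two_valued: "f \<in> two_valued S"
  by (auto simp: sign_pattern_def two_valued_def)

lemma atoms_alt: "(\<And>i. i < M \<Longrightarrow> 0 \<le> w i) \<Longrightarrow> 0 < sum w {..<M} \<Longrightarrow> atoms S g M w"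
  by unfold_locales (simp_all add: alt_space alt_sets)

lemma H_nonempty: "H \<noteq> {}"
  using alt_shatter[of "{}"] by auto

text \<open>At least D points are mislabelled, each of weight at least 1, out of a total weight of
  at most 60 * 4 D.\<close>

lemma far_instance:
  assumes w: "\<And>i. i < M \<Longrightarrow> 1 \<le> w i" "sum w {..<M} \<le> 60 * real M"
  shows "1 / 240 \<le> class_dist (atomic S g M w) f H"
  unfolding class_dist_def
proof (rule cINF_greatest[OF H_nonempty])
  fix h assume h: "h \<in> H"
  have W: "real M \<le> sum w {..<M}"
    using w(1) sum_bounded_below[of "{..<M}" 1 w] by simp
  interpret atoms S g M w
    using order.trans[OF zero_le_one w(1)] W D by (intro atoms_alt) auto
  let ?e = "\<lambda>i. of_bool (f (g i) \<noteq> h (g i)) :: real"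
  let ?J = "{j. j < 2 * D \<and> h (g (2 * j)) = 1 \<and> h (g (2 * j + 1)) = -1}"
  have "real D \<le> (\<Sum>j<2 * D. 1 - of_bool (j \<in> ?J))"
    using alt_changes[OF h] by (simp add: sum_subtractf Int_def conj_commute)
  also have "\<dots> \<le> (\<Sum>j<2 * D. ?e (2 * j) + ?e (2 * j + 1))"
    by (rule sum_mono) (auto simp: sign_pattern_g)
  also have "\<dots> = (\<Sum>i<M. ?e i)" using sum_pairs[of ?e "2 * D"] by simp
  also have "\<dots> \<le> (\<Sum>i<M. w i * ?e i)"
    using w(1) by (intro sum_mono) auto
  finally have "real D / sum w {..<M} \<le> fun_dist dst f h"
    unfolding fun_dist_D using w_pos by (simp add: divide_right_mono sum_divide_distrib[symmetric] del: sum_mult_of_bool_eq)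
  moreover have "1 / 240 \<le> real D / sum w {..<M}"
    using w(2) w_pos by (simp add: field_simps)
  ultimately show "1 / 240 \<le> fun_dist (atomic S g M w) f h" by (rule order.trans[rotated])
qed

lemma close_instance:
  assumes "card {i. i < M \<and> w i \<noteq> 0} \<le> D"
  obtains h where "h \<in> H" "\<And>i. i < M \<Longrightarrow> w i \<noteq> 0 \<Longrightarrow> h (g i) = f (g i)"
proof -
  have "{i. i < M \<and> w i \<noteq> 0} \<subseteq> {..<M}" by auto
  from alt_shatter[OF this assms] show thesis using that sign_pattern_g by auto
qed

text \<open>All instances used share the label function, so the verdict depends on the seed
  \<open>r\<close> and the drawn points only. \<open>a\<close> and \<open>b\<close> become the inner
  measures of the seeds that accept and reject.\<close>

lemma query_tester_bound:
  assumes q: "query_tester S \<epsilon> H q R A" and \<epsilon>: "\<epsilon> \<le> 1 / 240"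
  shows "real D / (264000000 * ln (4 * real D)) \<le> real q"
proof -
  let ?Acc = "\<lambda>r s. run f s 0 (A r)"
  interpret R: prob_space R using q by (simp add: query_tester_def)
  have q1: "2 / 3 \<le> \<P>((r, s) in exec_space R D' q. ?Acc r s)"
    if "(D', f) \<in> instances S" "class_dist D' f H = 0" for D'
    using q that unfolding query_tester_def by blast
  have q2: "2 / 3 \<le> \<P>((r, s) in exec_space R D' q. \<not> ?Acc r s)"
    if "(D', f) \<in> instances S" "\<epsilon> \<le> class_dist D' f H" for D'
    using q that unfolding query_tester_def by blast
  show ?thesis
  proof (rule sample_size_bound[OF D refl])
    fix l
    show "0 \<le> inner_measure R {r \<in> space R. ?Acc r (draws g l)}"
         "0 \<le> inner_measure R {r \<in> space R. \<not> ?Acc r (draws g l)}"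
      by (rule R.inner_nonneg)+
    show "inner_measure R {r \<in> space R. ?Acc r (draws g l)} +
        inner_measure R {r \<in> space R. \<not> ?Acc r (draws g l)} \<le> 1"
      by (rule R.inner_add_le) auto
  next
    fix w :: "nat \<Rightarrow> real"
    assume w: "\<And>i. i < M \<Longrightarrow> 0 \<le> w i" "0 < sum w {..<M}" "card {i. i < M \<and> w i \<noteq> 0} \<le> D"
    interpret atoms S g M w using w by (intro atoms_alt)
    obtain h where h: "h \<in> H" "\<And>i. i < M \<Longrightarrow> w i \<noteq> 0 \<Longrightarrow> h (g i) = f (g i)"
      using close_instance[OF w(3)] by blast
    have "fun_dist dst f h = 0"
      unfolding fun_dist_D using h(2) by (intro sum.neutral) auto
    moreover have "0 \<le> fun_dist dst f h'" for h' by (simp add: fun_dist_def)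
    ultimately have "class_dist dst f H = 0"
      unfolding class_dist_def using h(1)
      by (intro antisym cINF_greatest[OF H_nonempty] cINF_lower2[of _ _ h]) (auto intro!: bdd_belowI[of _ 0])
    from q1[OF instance_D[OF sign_pattern_two_valued] this]
      prob_exec_space_le[OF R.prob_space_axioms, of q ?Acc]
    show "2 / 3 \<le> wsum (\<lambda>i. w i / sum w {..<M}) {..<M} q (\<lambda>l. inner_measure R {r \<in> space R. ?Acc r (draws g l)})"
      by linarith
  next
    fix w :: "nat \<Rightarrow> real"
    assume w: "\<And>i. i < M \<Longrightarrow> 1 \<le> w i" "sum w {..<M} \<le> 60 * real M"
    have W: "real M \<le> sum w {..<M}"
      using w(1) sum_bounded_below[of "{..<M}" 1 w] by simp
    interpret atoms S g M w
      using order.trans[OF zero_le_one w(1)] W D by (intro atoms_alt) auto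
    have "\<epsilon> \<le> class_dist dst f H" using far_instance[OF w] \<epsilon> by simp
    from q2[OF instance_D[OF sign_pattern_two_valued] this]
      prob_exec_space_le[OF R.prob_space_axioms, of q "\<lambda>r s. \<not> ?Acc r s"]
    show "2 / 3 \<le> wsum (\<lambda>i. w i / sum w {..<M}) {..<M} q (\<lambda>l. inner_measure R {r \<in> space R. \<not> ?Acc r (draws g l)})"
      by linarith
  qed
qed

lemma labelled_draws:
  assumes "length l = m" "\<And>i. i \<in> set l \<Longrightarrow> h (g i) = h' (g i)"
  shows "labelled h m (draws g l) = labelled h' m (draws g l)"
  using assms by (auto simp: labelled_def draws_def)

text \<open>Acceptance is promised only for members of \<open>H\<close>; distance 0 is not enough.
  So the tester is run on a member \<open>h\<close> that fits the pattern on the support: on samples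
  of nonzero weight, its labels are those of the pattern.\<close>

lemma sample_tester_bound:
  assumes q: "sample_tester S \<epsilon> H m R A" and \<epsilon>: "\<epsilon> \<le> 1 / 240"
  shows "real D / (264000000 * ln (4 * real D)) \<le> real m"
proof -
  let ?Acc = "\<lambda>h r s. A r (labelled h m s)"
  interpret R: prob_space R using q by (simp add: sample_tester_def)
  have q1: "2 / 3 \<le> \<P>((r, s) in exec_space R D' m. ?Acc h r s)"
    if "(D', h) \<in> instances S" "h \<in> H" for D' h
    using q that unfolding sample_tester_def by blast
  have q2: "2 / 3 \<le> \<P>((r, s) in exec_space R D' m. \<not> ?Acc f r s)"
    if "(D', f) \<in> instances S" "\<epsilon> \<le> class_dist D' f H" for D'
    using q that unfolding sample_tester_def by blast
  show ?thesis
  proof (rule sample_size_bound[OF D refl])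
    fix l
    show "0 \<le> inner_measure R {r \<in> space R. ?Acc f r (draws g l)}"
         "0 \<le> inner_measure R {r \<in> space R. \<not> ?Acc f r (draws g l)}"
      by (rule R.inner_nonneg)+
    show "inner_measure R {r \<in> space R. ?Acc f r (draws g l)} +
        inner_measure R {r \<in> space R. \<not> ?Acc f r (draws g l)} \<le> 1"
      by (rule R.inner_add_le) auto
  next
    fix w :: "nat \<Rightarrow> real"
    assume w: "\<And>i. i < M \<Longrightarrow> 0 \<le> w i" "0 < sum w {..<M}" "card {i. i < M \<and> w i \<noteq> 0} \<le> D"
    interpret atoms S g M w using w by (intro atoms_alt)
    obtain h where h: "h \<in> H" "\<And>i. i < M \<Longrightarrow> w i \<noteq> 0 \<Longrightarrow> h (g i) = f (g i)"
      using close_instance[OF w(3)] by blast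
    have "2 / 3 \<le> wsum p {..<M} m (\<lambda>l. inner_measure R {r \<in> space R. ?Acc h r (draws g l)})"
      using q1[OF instance_D h(1)] h(1) alt_two_valued
        prob_exec_space_le[OF R.prob_space_axioms, of m "?Acc h"] by fastforce
    also have "\<dots> = wsum p {..<M} m (\<lambda>l. inner_measure R {r \<in> space R. ?Acc f r (draws g l)})"
    proof (rule wsum_cong)
      fix l assume l: "set l \<subseteq> {..<M}" "length l = m" "prod_list (map p l) \<noteq> 0"
      have "h (g i) = f (g i)" if "i \<in> set l" for i
        using l that by (intro h(2)) (auto simp: prod_list_zero_iff)
      then show "inner_measure R {r \<in> space R. ?Acc h r (draws g l)} =
          inner_measure R {r \<in> space R. ?Acc f r (draws g l)}"
        by (simp add: labelled_draws[OF l(2), of h f])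
    qed
    finally show "2 / 3 \<le> wsum (\<lambda>i. w i / sum w {..<M}) {..<M} m (\<lambda>l. inner_measure R {r \<in> space R. ?Acc f r (draws g l)})" .
  next
    fix w :: "nat \<Rightarrow> real"
    assume w: "\<And>i. i < M \<Longrightarrow> 1 \<le> w i" "sum w {..<M} \<le> 60 * real M"
    have W: "real M \<le> sum w {..<M}"
      using w(1) sum_bounded_below[of "{..<M}" 1 w] by simp
    interpret atoms S g M w
      using order.trans[OF zero_le_one w(1)] W D by (intro atoms_alt) auto
    have "\<epsilon> \<le> class_dist dst f H" using far_instance[OF w] \<epsilon> by simp
    from q2[OF instance_D[OF sign_pattern_two_valued] this]
      prob_exec_space_le[OF R.prob_space_axioms, of m "\<lambda>r s. \<not> ?Acc f r s"]
    show "2 / 3 \<le> wsum (\<lambda>i. w i / sum w {..<M}) {..<M} m (\<lambda>l. inner_measure R {r \<in> space R. \<not> ?Acc f r (draws g l)})"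
      by linarith
  qed
qed

end

text \<open>A nonempty infimum is attained; without any tester it is infinite.\<close>

lemma le_Inf_enat:
  assumes "\<And>k. P k \<Longrightarrow> x \<le> real k"
  shows "ereal x \<le> ereal_of_enat (Inf {enat k | k. P k})"
proof (cases "\<exists>k. P k")
  case True
  then have "Inf {enat k | k. P k} \<in> {enat k | k. P k}"
    unfolding Inf_enat_def by (smt (verit) LeastI_ex empty_iff mem_Collect_eq)
  then show ?thesis using assms by auto
qed (simp add: Inf_enat_def)

text \<open>\<open>N\<close> is the parameter of the theorem and \<open>D\<close> the dimension of
  the Chebyshev system, such as 2 d + 1 for d. From 4 D <= 12 N <= N^5 comes the factor 5 in
  1320000000 = 5 * 264000000.\<close>

lemma test_lower_bounds:
  assumes "alternating S H D g" and N: "2 \<le> N" "N \<le> D" "D \<le> 3 * N" and \<epsilon>: "\<epsilon> \<le> 1 / 240"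
  shows "ereal (1 / 1320000000 * real N / ln (real N)) \<le> ereal_of_enat (m_test S \<epsilon> H)"
    and "ereal (1 / 1320000000 * real N / ln (real N)) \<le> ereal_of_enat (q_test0 S \<epsilon> H)"
proof -
  interpret alternating S H D g by fact
  have "12 * real N \<le> real N ^ 5"
  proof -
    have "(2 :: real) ^ 4 \<le> real N ^ 4" using N(1) by (intro power_mono) auto
    then have "12 * real N \<le> real N ^ 4 * real N" by (intro mult_right_mono) auto
    then show ?thesis by (simp add: power_numeral_reduce)
  qed
  then have "4 * real D \<le> real N ^ 5" using N by linarith
  then have "ln (4 * real D) \<le> ln (real N ^ 5)" using D N by simp
  also have "\<dots> = 5 * ln (real N)" using N(1) by (simp add: ln_realpow)
  finally have "real N / (264000000 * (5 * ln (real N))) \<le> real D / (264000000 * ln (4 * real D))"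
    using N D by (intro frac_le mult_left_mono mult_pos_pos ln_gt_zero) auto
  then have le: "1 / 1320000000 * real N / ln (real N) \<le> real D / (264000000 * ln (4 * real D))"
    by simp
  show "ereal (1 / 1320000000 * real N / ln (real N)) \<le> ereal_of_enat (m_test S \<epsilon> H)"
    unfolding m_test_def using sample_tester_bound[OF _ \<epsilon>] le
    by (intro le_Inf_enat) (blast intro: order.trans)
  show "ereal (1 / 1320000000 * real N / ln (real N)) \<le> ereal_of_enat (q_test0 S \<epsilon> H)"
    unfolding q_test0_def using query_tester_bound[OF _ \<epsilon>] le
    by (intro le_Inf_enat) (blast intro: order.trans)
qed

section \<open>Chebyshev systems\<close>

text \<open>Rolle's theorem: zeros are added in increasing order, and each new one brings a zero of
  \<open>f'\<close> above the previous maximum. Hence the induction counts only the zeros of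
  \<open>f'\<close> below \<open>Max F\<close>.\<close>

lemma card_zeros_le_Suc_deriv:
  fixes f f' :: "real \<Rightarrow> real"
  assumes deriv: "\<And>t. 0 < t \<Longrightarrow> (f has_real_derivative f' t) (at t)"
    and fin: "finite {t. 0 < t \<and> f' t = 0}"
  shows "finite {t. 0 < t \<and> f t = 0} \<and> card {t. 0 < t \<and> f t = 0} \<le> Suc (card {t. 0 < t \<and> f' t = 0})"
proof -
  let ?Z = "{t. 0 < t \<and> f t = 0}" and ?Z' = "{t. 0 < t \<and> f' t = 0}"
  have fs: "finite {s \<in> ?Z'. s < y}" for y
    by (rule finite_subset[OF _ fin]) auto
  have *: "card F \<le> Suc (card {s \<in> ?Z'. s < Max F})" if "finite F" "F \<subseteq> ?Z" "F \<noteq> {}" for F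
    using that
  proof (induction rule: finite_linorder_max_induct)
    case (insert b F)
    show ?case
    proof (cases "F = {}")
      case False
      define a where "a = Max F"
      have a: "a \<in> F" using False insert(1) by (simp add: a_def)
      then have ab: "0 < a" "a < b" "f a = 0" "f b = 0" using insert by auto
      obtain s where s: "a < s" "s < b" "f b - f a = (b - a) * f' s"
        using MVT2[of a b f f'] deriv ab by force
      have "card F \<le> Suc (card {s \<in> ?Z'. s < a})" using insert False by (simp add: a_def)
      also have "\<dots> = card (Set.insert s {s \<in> ?Z'. s < a})"
        by (subst card_insert_disjoint[OF fs]) (use s in auto)
      also have "\<dots> \<le> card {s \<in> ?Z'. s < b}"
        using s ab by (intro card_mono[OF fs]) auto
      finally have "card F \<le> card {s \<in> ?Z'. s < b}" .
      moreover have "Max (Set.insert b F) = b" using insert by (intro Max_eqI) auto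
      moreover have "b \<notin> F" using insert(2) by auto
      ultimately show ?thesis using insert(1) by simp
    qed simp
  qed simp
  have bound: "card F \<le> Suc (card ?Z')" if "finite F" "F \<subseteq> ?Z" for F
  proof (cases "F = {}")
    case False
    then have "card F \<le> Suc (card {s \<in> ?Z'. s < Max F})" using * that by blast
    also have "\<dots> \<le> Suc (card ?Z')" by (intro Suc_le_mono[THEN iffD2] card_mono[OF fin]) auto
    finally show ?thesis .
  qed simp
  have "finite ?Z"
  proof (rule ccontr)
    assume "infinite ?Z"
    then obtain F where "finite F" "card F = Suc (Suc (card ?Z'))" "F \<subseteq> ?Z"
      using infinite_arbitrarily_large by blast
    then show False using bound[of F] by simp
  qed
  then show ?thesis using bound by simp
qed

text \<open>A weak form of Descartes' rule of signs, by dividing out the lowest power and Rolle's theorem.\<close>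

lemma card_pos_zeros_less:
  fixes c :: "'i \<Rightarrow> real" and e :: "'i \<Rightarrow> nat"
  assumes "finite A" "inj_on e A" "\<exists>\<alpha>\<in>A. c \<alpha> \<noteq> 0"
  defines "Z \<equiv> {t. 0 < t \<and> (\<Sum>\<alpha>\<in>A. c \<alpha> * t ^ e \<alpha>) = 0}"
  shows "finite Z \<and> card Z < card A"
  unfolding Z_def using assms(1-3)
proof (induction "card A" arbitrary: A c e)
  case 0
  then show ?case by auto
next
  case (Suc n)
  let ?Z = "{t. 0 < t \<and> (\<Sum>\<alpha>\<in>A. c \<alpha> * t ^ e \<alpha>) = 0}"
  have ne: "A \<noteq> {}" using Suc by auto
  obtain \<alpha>0 where \<alpha>0: "\<alpha>0 \<in> A" "e \<alpha>0 = Min (e ` A)"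
    using Min_in[of "e ` A"] Suc ne by fastforce
  have ge: "e \<alpha>0 \<le> e \<alpha>" if "\<alpha> \<in> A" for \<alpha>
    using \<alpha>0(2) that Suc by simp
  define B where "B = A - {\<alpha>0}"
  have A: "A = insert \<alpha>0 B" "\<alpha>0 \<notin> B" "finite B" using \<alpha>0 Suc by (auto simp: B_def)
  have gt: "e \<alpha>0 < e \<alpha>" if "\<alpha> \<in> B" for \<alpha>
    using ge[of \<alpha>] that \<alpha>0(1) Suc.prems(2) by (auto simp: B_def inj_on_def le_less)
  have cardB: "n = card B" using Suc.hyps(2) A by simp
  show ?case
  proof (cases "\<exists>\<alpha>\<in>B. c \<alpha> \<noteq> 0")
    case True
    define h where "h t = (\<Sum>\<alpha>\<in>A. c \<alpha> * t ^ (e \<alpha> - e \<alpha>0))" for t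
    define h' where "h' t = (\<Sum>\<alpha>\<in>B. (c \<alpha> * real (e \<alpha> - e \<alpha>0)) * t ^ (e \<alpha> - e \<alpha>0 - 1))" for t
    have "(\<Sum>\<alpha>\<in>A. c \<alpha> * t ^ e \<alpha>) = t ^ e \<alpha>0 * h t" for t
      unfolding h_def sum_distrib_left
      by (rule sum.cong) (auto simp: ge power_add[symmetric] mult.left_commute)
    then have Z: "?Z = {t. 0 < t \<and> h t = 0}" by auto
    have "(h has_real_derivative (\<Sum>\<alpha>\<in>A. c \<alpha> * (real (e \<alpha> - e \<alpha>0) * t ^ (e \<alpha> - e \<alpha>0 - 1)))) (at t)" for t
      unfolding h_def
      by (intro DERIV_sum DERIV_cmult) (auto intro!: derivative_eq_intros)
    then have "(h has_real_derivative h' t) (at t)" for t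
      unfolding A(1) using A by (simp add: h'_def mult.assoc)
    moreover have IH: "finite {t. 0 < t \<and> h' t = 0} \<and> card {t. 0 < t \<and> h' t = 0} < card B"
      unfolding h'_def
    proof (rule Suc.hyps(1)[OF cardB A(3)])
      show "inj_on (\<lambda>\<alpha>. e \<alpha> - e \<alpha>0 - 1) B"
      proof (rule inj_onI)
        fix \<alpha> \<beta> assume *: "\<alpha> \<in> B" "\<beta> \<in> B" "e \<alpha> - e \<alpha>0 - 1 = e \<beta> - e \<alpha>0 - 1"
        then have "e \<alpha> = e \<beta>" using gt[of \<alpha>] gt[of \<beta>] by linarith
        then show "\<alpha> = \<beta>" using * Suc.prems(2) by (auto simp: B_def inj_on_def)
      qed
      show "\<exists>\<alpha>\<in>B. c \<alpha> * real (e \<alpha> - e \<alpha>0) \<noteq> 0" using True gt by fastforce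
    qed
    ultimately have "finite {t. 0 < t \<and> h t = 0} \<and> card {t. 0 < t \<and> h t = 0} \<le> Suc (card {t. 0 < t \<and> h' t = 0})"
      by (intro card_zeros_le_Suc_deriv) auto
    then show ?thesis unfolding Z using IH cardB Suc.hyps(2) by linarith
  next
    case False
    then have "c \<alpha>0 \<noteq> 0" using Suc.prems(3) A by auto
    moreover have "(\<Sum>\<alpha>\<in>A. c \<alpha> * t ^ e \<alpha>) = c \<alpha>0 * t ^ e \<alpha>0" for t
      using A False by (simp add: sum.neutral)
    ultimately have "?Z = {}" by auto
    then show ?thesis using Suc.hyps(2) by (metis card.empty finite.emptyI zero_less_Suc)
  qed
qed

text \<open>Gaussian elimination: the equation at \<open>t\<close> eliminates an unknown \<beta>
  with \<open>\<phi> \<beta> t \<noteq> 0\<close>. The induction generalises \<phi>, as elimination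
  changes it.\<close>

lemma homogeneous_solution:
  fixes \<phi> :: "'i \<Rightarrow> 'b \<Rightarrow> real"
  assumes "finite T" "finite A" "card T < card A"
  shows "\<exists>c. (\<exists>\<alpha>\<in>A. c \<alpha> \<noteq> 0) \<and> (\<forall>t\<in>T. (\<Sum>\<alpha>\<in>A. c \<alpha> * \<phi> \<alpha> t) = 0)"
  using assms
proof (induction T arbitrary: A \<phi> rule: finite_induct)
  case empty
  then have "A \<noteq> {}" by auto
  then show ?case by (intro exI[of _ "\<lambda>_. 1"]) auto
next
  case (insert t T)
  show ?case
  proof (cases "\<forall>\<alpha>\<in>A. \<phi> \<alpha> t = 0")
    case True
    have "card T < card A" using insert by simp
    from insert.IH[OF insert.prems(1) this, of \<phi>]
    obtain c where "\<exists>\<alpha>\<in>A. c \<alpha> \<noteq> 0" "\<forall>t\<in>T. (\<Sum>\<alpha>\<in>A. c \<alpha> * \<phi> \<alpha> t) = 0"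
      by blast
    then show ?thesis using True by (intro exI[of _ c]) auto
  next
    case False
    then obtain \<beta> where \<beta>: "\<beta> \<in> A" "\<phi> \<beta> t \<noteq> 0" by auto
    define B where "B = A - {\<beta>}"
    have A: "A = Set.insert \<beta> B" "\<beta> \<notin> B" "finite B" using \<beta> insert by (auto simp: B_def)
    have "card T < card B" using insert A by simp
    from insert.IH[OF A(3) this, of "\<lambda>\<alpha> s. \<phi> \<alpha> s - \<phi> \<alpha> t / \<phi> \<beta> t * \<phi> \<beta> s"]
    obtain c where c: "\<exists>\<alpha>\<in>B. c \<alpha> \<noteq> 0"
      "\<forall>s\<in>T. (\<Sum>\<alpha>\<in>B. c \<alpha> * (\<phi> \<alpha> s - \<phi> \<alpha> t / \<phi> \<beta> t * \<phi> \<beta> s)) = 0"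
      by blast
    define b where "b = - (\<Sum>\<alpha>\<in>B. c \<alpha> * \<phi> \<alpha> t) / \<phi> \<beta> t"
    have "(\<Sum>\<alpha>\<in>A. (c(\<beta> := b)) \<alpha> * \<phi> \<alpha> s) = b * \<phi> \<beta> s + (\<Sum>\<alpha>\<in>B. c \<alpha> * \<phi> \<alpha> s)" for s
      unfolding A(1) using A by (simp, intro sum.cong) auto
    also have "b * \<phi> \<beta> s + (\<Sum>\<alpha>\<in>B. c \<alpha> * \<phi> \<alpha> s) =
        (\<Sum>\<alpha>\<in>B. c \<alpha> * (\<phi> \<alpha> s - \<phi> \<alpha> t / \<phi> \<beta> t * \<phi> \<beta> s))" for s
      by (simp add: b_def sum_subtractf right_diff_distrib sum_distrib_right sum_divide_distrib mult.assoc
          sum_negf[symmetric])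
    finally have eq: "(\<Sum>\<alpha>\<in>A. (c(\<beta> := b)) \<alpha> * \<phi> \<alpha> s) =
        (\<Sum>\<alpha>\<in>B. c \<alpha> * (\<phi> \<alpha> s - \<phi> \<alpha> t / \<phi> \<beta> t * \<phi> \<beta> s))" for s .
    show ?thesis
    proof (intro exI[of _ "c(\<beta> := b)"] conjI ballI)
      show "\<exists>\<alpha>\<in>A. (c(\<beta> := b)) \<alpha> \<noteq> 0" using c(1) A by auto
      fix s assume "s \<in> Set.insert t T"
      then show "(\<Sum>\<alpha>\<in>A. (c(\<beta> := b)) \<alpha> * \<phi> \<alpha> s) = 0"
        unfolding eq using c(2) \<beta>(2) by auto
    qed
  qed
qed

section \<open>Interpolation and sign changes in Chebyshev systems\<close>

locale chebyshev_system =
  fixes A :: "'i set" and \<phi> :: "'i \<Rightarrow> real \<Rightarrow> real" and I :: "real set"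
  assumes finite_A: "finite A"
    and zeros: "\<And>c. \<exists>\<alpha>\<in>A. c \<alpha> \<noteq> 0 \<Longrightarrow>
      finite {t \<in> I. (\<Sum>\<alpha>\<in>A. c \<alpha> * \<phi> \<alpha> t) = 0} \<and> card {t \<in> I. (\<Sum>\<alpha>\<in>A. c \<alpha> * \<phi> \<alpha> t) = 0} < card A"
    and continuous: "\<And>\<alpha>. \<alpha> \<in> A \<Longrightarrow> continuous_on I (\<phi> \<alpha>)"
    and interval: "is_interval I"
begin

definition comb :: "('i \<Rightarrow> real) \<Rightarrow> real \<Rightarrow> real" where
  "comb c t = (\<Sum>\<alpha>\<in>A. c \<alpha> * \<phi> \<alpha> t)"

text \<open>Counting equations gives a nonzero combination that vanishes at all points of
  \<open>T\<close> but one; by \<open>zeros\<close> it cannot vanish there too. Scaled, these form a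
  Lagrange basis.\<close>

lemma interpolation:
  assumes T: "finite T" "T \<subseteq> I" "card T = card A"
  shows "\<exists>c. \<forall>t\<in>T. comb c t = v t"
proof -
  have "\<exists>c. comb c t = 1 \<and> (\<forall>s\<in>T - {t}. comb c s = 0)" if t: "t \<in> T" for t
  proof -
    have "card (T - {t}) < card A"
      using t T by (metis card_Diff1_less)
    then obtain c where c: "\<exists>\<alpha>\<in>A. c \<alpha> \<noteq> 0" "\<forall>s\<in>T - {t}. comb c s = 0"
      using homogeneous_solution[of "T - {t}" A \<phi>] T(1) finite_A by (auto simp: comb_def)
    have "comb c t \<noteq> 0"
    proof
      assume "comb c t = 0"
      then have "T \<subseteq> {t \<in> I. (\<Sum>\<alpha>\<in>A. c \<alpha> * \<phi> \<alpha> t) = 0}"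
        using c(2) T(2) by (auto simp: comb_def)
      then have "card T \<le> card {t \<in> I. (\<Sum>\<alpha>\<in>A. c \<alpha> * \<phi> \<alpha> t) = 0}"
        using zeros[OF c(1)] by (intro card_mono) auto
      then show False using zeros[OF c(1)] T(3) by linarith
    qed
    moreover have "comb (\<lambda>\<alpha>. c \<alpha> / d) s = comb c s / d" for d s
      by (simp add: comb_def sum_divide_distrib)
    ultimately show ?thesis using c(2) by (intro exI[of _ "\<lambda>\<alpha>. c \<alpha> / comb c t"]) auto
  qed
  then have "\<forall>t\<in>T. \<exists>c. comb c t = 1 \<and> (\<forall>s\<in>T - {t}. comb c s = 0)" by blast
  from bchoice[OF this] obtain L
    where L: "\<forall>t\<in>T. comb (L t) t = 1 \<and> (\<forall>s\<in>T - {t}. comb (L t) s = 0)" by blast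
  have "comb (\<lambda>\<alpha>. \<Sum>t\<in>T. v t * L t \<alpha>) s = v s" if "s \<in> T" for s
  proof -
    have "comb (\<lambda>\<alpha>. \<Sum>t\<in>T. v t * L t \<alpha>) s = (\<Sum>t\<in>T. v t * comb (L t) s)"
      unfolding comb_def sum_distrib_left sum_distrib_right by (subst sum.swap) (simp add: mult_ac)
    also have "\<dots> = (\<Sum>t\<in>T. if t = s then v s else 0)"
      using L that by (intro sum.cong) auto
    finally show ?thesis using that T(1) by simp
  qed
  then show ?thesis by blast
qed

text \<open>A drop inside a pair forces a zero in it, and disjoint pairs give different zeros. The
  zero may be the left end, since \<open>pm_sign 0 = 1\<close>, but never the right one.\<close>

lemma sign_changes:
  fixes x :: "nat \<Rightarrow> real"
  assumes x: "\<And>i j. i < j \<Longrightarrow> j < 2 * n \<Longrightarrow> x i < x j" "\<And>i. i < 2 * n \<Longrightarrow> x i \<in> I"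
  shows "card {j. j < n \<and> 0 \<le> comb c (x (2 * j)) \<and> comb c (x (2 * j + 1)) < 0} \<le> card A"
    (is "card ?J \<le> _")
proof (cases "\<exists>\<alpha>\<in>A. c \<alpha> \<noteq> 0")
  case False
  then have "comb c t = 0" for t by (simp add: comb_def)
  then show ?thesis by simp
next
  case True
  have cont: "continuous_on I (comb c)"
    unfolding comb_def using continuous by (intro continuous_on_sum continuous_on_mult_left) auto
  have "\<exists>z. x (2 * j) \<le> z \<and> z < x (2 * j + 1) \<and> z \<in> I \<and> comb c z = 0" if j: "j \<in> ?J" for j
  proof -
    have j': "2 * j < 2 * n" "2 * j + 1 < 2 * n" using j by auto
    have sub: "{x (2 * j)..x (2 * j + 1)} \<subseteq> I"
      using mem_is_interval_1_I[OF interval x(2)[OF j'(1)] x(2)[OF j'(2)]] by (meson atLeastAtMost_iff subsetI)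
    have "x (2 * j) \<le> x (2 * j + 1)" using x(1)[of "2 * j" "2 * j + 1"] j' by simp
    then obtain z where z: "x (2 * j) \<le> z" "z \<le> x (2 * j + 1)" "comb c z = 0"
      using IVT2'[of "comb c" "x (2 * j + 1)" 0 "x (2 * j)"] continuous_on_subset[OF cont sub] j by auto
    then have "z \<noteq> x (2 * j + 1)" using j by auto
    then show ?thesis using z sub by (intro exI[of _ z]) auto
  qed
  then have "\<forall>j\<in>?J. \<exists>z. x (2 * j) \<le> z \<and> z < x (2 * j + 1) \<and> z \<in> I \<and> comb c z = 0" by blast
  from bchoice[OF this] obtain z
    where z: "\<And>j. j \<in> ?J \<Longrightarrow> x (2 * j) \<le> z j \<and> z j < x (2 * j + 1) \<and> z j \<in> I \<and> comb c (z j) = 0" by blast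
  have less: "z i < z j" if "i \<in> ?J" "j \<in> ?J" "i < j" for i j
  proof -
    have "x (2 * i + 1) \<le> x (2 * j)"
      using x(1)[of "2 * i + 1" "2 * j"] that by auto
    then show ?thesis using z[OF that(1)] z[OF that(2)] by linarith
  qed
  have "inj_on z ?J"
  proof (rule inj_onI)
    fix i j assume "i \<in> ?J" "j \<in> ?J" "z i = z j"
    then show "i = j" using less[of i j] less[of j i] by (cases i j rule: linorder_cases) auto
  qed
  then have "card ?J = card (z ` ?J)" by (simp add: card_image)
  also have "\<dots> \<le> card {t \<in> I. (\<Sum>\<alpha>\<in>A. c \<alpha> * \<phi> \<alpha> t) = 0}"
    using zeros[OF True] z by (intro card_mono) (auto simp: comb_def)
  finally show ?thesis using zeros[OF True] by simp
qed

text \<open>\<open>represented\<close> has a separate case for the constant -1 because of balls of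
  negative radius, where the condition on the distance cannot be squared.\<close>

lemma alternating_curve:
  assumes "2 \<le> card A"
    and x: "\<And>i j. i < j \<Longrightarrow> j < 4 * card A \<Longrightarrow> x i < x j" "\<And>i. i < 4 * card A \<Longrightarrow> x i \<in> I"
    and g: "inj_on g {..<4 * card A}" "\<And>i. i < 4 * card A \<Longrightarrow> g i \<in> space S"
      "\<And>i. i < 4 * card A \<Longrightarrow> {g i} \<in> sets S"
    and H: "H \<subseteq> two_valued S"
    and realizable: "\<And>c. \<exists>h\<in>H. \<forall>i<4 * card A. h (g i) = pm_sign (comb c (x i))"
    and represented: "\<And>h. h \<in> H \<Longrightarrow>
      (\<forall>i<4 * card A. h (g i) = -1) \<or> (\<exists>c. \<forall>i<4 * card A. h (g i) = pm_sign (comb c (x i)))"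
  shows "alternating S H (card A) g"
proof
  fix J assume J: "J \<subseteq> {..<4 * card A}" "card J \<le> card A"
  \<comment> \<open>Interpolation wants exactly \<open>card A\<close> points, so \<open>J\<close> is
    enlarged.\<close>
  obtain K where K: "J \<subseteq> K" "K \<subseteq> {..<4 * card A}" "card K = card A"
    using exists_subset_between[of J "card A" "{..<4 * card A}"] J by auto
  have inj: "inj_on x K"
  proof (rule inj_onI)
    fix i j assume "i \<in> K" "j \<in> K" "x i = x j"
    then show "i = j" using x(1)[of i j] x(1)[of j i] K(2) by (cases i j rule: linorder_cases) auto
  qed
  have "finite K" using K(2) by (rule finite_subset) simp
  then obtain c where c: "\<forall>t\<in>x ` K. comb c t = (-1) ^ the_inv_into K x t"
    using interpolation[of "x ` K" "\<lambda>t. (-1) ^ the_inv_into K x t"] K x(2) inj by (auto simp: card_image)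
  obtain h where h: "h \<in> H" "\<forall>i<4 * card A. h (g i) = pm_sign (comb c (x i))"
    using realizable by blast
  have "h (g j) = (-1) ^ j" if "j \<in> J" for j
  proof -
    have "comb c (x j) = (-1) ^ j" using c that K the_inv_into_f_f[OF inj, of j] by auto
    then show ?thesis using h(2) that J(1) by (cases "even j") (auto simp: pm_sign_def)
  qed
  then show "\<exists>h\<in>H. \<forall>j\<in>J. h (g j) = (-1) ^ j" using h(1) by blast
next
  fix h assume "h \<in> H"
  then consider "\<forall>i<4 * card A. h (g i) = -1" | c where "\<forall>i<4 * card A. h (g i) = pm_sign (comb c (x i))"
    using represented by blast
  then show "card {j. j < 2 * card A \<and> h (g (2 * j)) = 1 \<and> h (g (2 * j + 1)) = -1} \<le> card A"
  proof cases
    case 1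
    then have "{j. j < 2 * card A \<and> h (g (2 * j)) = 1 \<and> h (g (2 * j + 1)) = -1} = {}" by auto
    then show ?thesis by (simp only: card.empty)
  next
    case 2
    have "{j. j < 2 * card A \<and> h (g (2 * j)) = 1 \<and> h (g (2 * j + 1)) = -1} =
        {j. j < 2 * card A \<and> 0 \<le> comb c (x (2 * j)) \<and> comb c (x (2 * j + 1)) < 0}"
    proof -
      have "h (g i) = 1 \<longleftrightarrow> 0 \<le> comb c (x i)" "h (g i) = -1 \<longleftrightarrow> comb c (x i) < 0" if "i < 4 * card A" for i
        using 2 that by (auto simp: pm_sign_def)
      then show ?thesis by (intro Collect_cong conj_cong) auto
    qed
    then show ?thesis using sign_changes[of "2 * card A" x c] x by simp
  qed
qed (use assms in auto)

end

section \<open>The three classes\<close>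

lemma space_Rn: "space (Rn n) = {..<n} \<rightarrow>\<^sub>E UNIV"
  by (simp add: space_PiM)

lemma singleton_sets_Rn:
  assumes "x \<in> space (Rn n)"
  shows "{x} \<in> sets (Rn n)"
proof -
  have "{x} = Pi\<^sub>E {..<n} (\<lambda>i. {x i})"
    using assms by (intro PiE_singleton[symmetric]) (simp add: space_Rn PiE_iff)
  also have "\<dots> \<in> sets (Rn n)" by (intro sets_PiM_I_finite) auto
  finally show ?thesis .
qed

lemma pm_sign_neq [simp]: "pm_sign z \<noteq> -1 \<longleftrightarrow> pm_sign z = 1"
  by (simp add: pm_sign_def)

lemma restrict_pm_sign_two_valued: "restrict (\<lambda>x. pm_sign (F x)) (space S) \<in> two_valued S"
  by (auto simp: two_valued_def)

section \<open>Polynomial threshold functions on a curve\<close>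

lemma digits_inj:
  fixes a b :: "nat \<Rightarrow> nat"
  assumes "\<And>i. i < n \<Longrightarrow> a i < K" "\<And>i. i < n \<Longrightarrow> b i < K"
    and "(\<Sum>i<n. a i * K ^ i) = (\<Sum>i<n. b i * K ^ i)"
  shows "\<forall>i<n. a i = b i"
  using assms
proof (induction n arbitrary: a b)
  case (Suc n)
  have split: "(\<Sum>i<Suc n. d i * K ^ i) = d 0 + K * (\<Sum>i<n. d (Suc i) * K ^ i)" for d :: "nat \<Rightarrow> nat"
    unfolding sum.lessThan_Suc_shift by (simp add: sum_distrib_left mult_ac)
  have lt: "a 0 < K" "b 0 < K" using Suc.prems by auto
  have eq: "a 0 + K * (\<Sum>i<n. a (Suc i) * K ^ i) = b 0 + K * (\<Sum>i<n. b (Suc i) * K ^ i)"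
    using Suc.prems(3) unfolding split .
  have "a 0 = b 0"
    using arg_cong[OF eq, of "\<lambda>x. x mod K"] lt by simp
  moreover have "(\<Sum>i<n. a (Suc i) * K ^ i) = (\<Sum>i<n. b (Suc i) * K ^ i)"
    using eq \<open>a 0 = b 0\<close> lt by simp
  then have "\<forall>i<n. a (Suc i) = b (Suc i)"
    using Suc.prems by (intro Suc.IH) auto
  ultimately show ?case by (auto simp: less_Suc_eq_0_disj)
qed simp

text \<open>A slack entry raises the degree to exactly k: exponent vectors become lists of length n
  + 1 with sum k, counted by stars and bars.\<close>

lemma card_exponents: "card (exponents n k) = (n + k) choose k"
proof -
  let ?L = "{l :: nat list. length l = n + 1 \<and> sum_list l = k}"
  have sl: "sum_list l = (\<Sum>i<n. l ! i) + l ! n" if "length l = n + 1" for l :: "nat list"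
    using that by (simp add: sum_list_sum_nth atLeast0LessThan)
  have "bij_betw (\<lambda>l. restrict (\<lambda>i. l ! i) {..<n}) ?L (exponents n k)"
  proof (rule bij_betw_byWitness[where f' = "\<lambda>\<alpha>. map \<alpha> [0..<n] @ [k - (\<Sum>i<n. \<alpha> i)]"])
    show "\<forall>l\<in>?L. map (restrict (\<lambda>i. l ! i) {..<n}) [0..<n] @ [k - (\<Sum>i<n. restrict (\<lambda>i. l ! i) {..<n} i)] = l"
    proof
      fix l assume l: "l \<in> ?L"
      then show "map (restrict (\<lambda>i. l ! i) {..<n}) [0..<n] @ [k - (\<Sum>i<n. restrict (\<lambda>i. l ! i) {..<n} i)] = l"
        using sl[of l] by (intro nth_equalityI) (auto simp: nth_append less_Suc_eq)
    qed
    show "\<forall>\<alpha>\<in>exponents n k. restrict (\<lambda>i. (map \<alpha> [0..<n] @ [k - (\<Sum>i<n. \<alpha> i)]) ! i) {..<n} = \<alpha>"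
      by (auto simp: exponents_def nth_append PiE_iff extensional_def intro!: ext)
    show "(\<lambda>l. restrict (\<lambda>i. l ! i) {..<n}) ` ?L \<subseteq> exponents n k"
    proof (rule image_subsetI)
      fix l assume "l \<in> ?L"
      then show "restrict (\<lambda>i. l ! i) {..<n} \<in> exponents n k"
        using sl[of l] unfolding exponents_def mem_Collect_eq restrict_PiE_iff by simp
    qed
    show "(\<lambda>\<alpha>. map \<alpha> [0..<n] @ [k - (\<Sum>i<n. \<alpha> i)]) ` exponents n k \<subseteq> ?L"
    proof (rule image_subsetI)
      fix \<alpha> assume \<alpha>: "\<alpha> \<in> exponents n k"
      have "sum_list (map \<alpha> [0..<n]) = (\<Sum>i<n. \<alpha> i)"
        unfolding interv_sum_list_conv_sum_set_nat set_upt atLeast0LessThan ..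
      then show "map \<alpha> [0..<n] @ [k - (\<Sum>i<n. \<alpha> i)] \<in> ?L" using \<alpha> by (simp add: exponents_def)
    qed
  qed
  then have "card (exponents n k) = card ?L" by (simp add: bij_betw_same_card)
  also have "\<dots> = (k + (n + 1) - 1) choose k" by (rule card_length_sum_list)
  finally show ?thesis by (simp add: add.commute)
qed

text \<open>
  On the curve \<open>t \<mapsto> (t, t ^ K, t ^ K\<^sup>2, \<dots>)\<close> with \<open>K = k + 1\<close>, distinct monomials of degree at
  most \<open>k\<close> become distinct powers of \<open>t\<close>.
\<close>

lemma alternating_PTF:
  assumes n: "1 \<le> n" and k: "1 \<le> k"
  shows "\<exists>g. alternating (Rn n) (PTF n k) ((n + k) choose k) g"
proof -
  let ?A = "exponents n k" and ?K = "k + 1"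
  define e where "e \<alpha> = (\<Sum>i<n. \<alpha> i * ?K ^ i)" for \<alpha> :: "nat \<Rightarrow> nat"
  have le: "\<alpha> i \<le> k" if "\<alpha> \<in> ?A" "i < n" for \<alpha> i
    using that member_le_sum[of i "{..<n}" \<alpha>] by (auto simp: exponents_def)
  have inj: "inj_on e ?A"
  proof (rule inj_onI)
    fix \<alpha> \<beta> assume *: "\<alpha> \<in> ?A" "\<beta> \<in> ?A" "e \<alpha> = e \<beta>"
    have "\<forall>i<n. \<alpha> i = \<beta> i"
      using * le by (intro digits_inj[where K = ?K]) (auto simp: e_def less_Suc_eq_le)
    then show "\<alpha> = \<beta>"
      using *(1,2) by (intro PiE_ext[of \<alpha> "{..<n}" "\<lambda>_. UNIV"]) (auto simp: exponents_def)
  qed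
  interpret chebyshev_system ?A "\<lambda>\<alpha> t. t ^ e \<alpha>" "{0<..}"
  proof
    fix c :: "(nat \<Rightarrow> nat) \<Rightarrow> real" assume c: "\<exists>\<alpha>\<in>?A. c \<alpha> \<noteq> 0"
    have "{t \<in> {0<..}. (\<Sum>\<alpha>\<in>?A. c \<alpha> * t ^ e \<alpha>) = 0} = {t. 0 < t \<and> (\<Sum>\<alpha>\<in>?A. c \<alpha> * t ^ e \<alpha>) = 0}"
      by auto
    then show "finite {t \<in> {0<..}. (\<Sum>\<alpha>\<in>?A. c \<alpha> * t ^ e \<alpha>) = 0} \<and>
        card {t \<in> {0<..}. (\<Sum>\<alpha>\<in>?A. c \<alpha> * t ^ e \<alpha>) = 0} < card ?A"
      using card_pos_zeros_less[OF finite_exponents inj c] by simp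
  qed (auto intro!: continuous_intros finite_exponents simp: is_interval_1)
  define g where "g i = (\<lambda>j\<in>{..<n}. real (Suc i) ^ ?K ^ j)" for i
  have g: "g i \<in> space (Rn n)" for i by (simp add: g_def space_Rn)
  have eval: "poly_eval n k a (g i) = comb a (real (Suc i))" for a i
  proof -
    have "(\<Prod>j<n. g i j ^ \<alpha> j) = real (Suc i) ^ e \<alpha>" for \<alpha>
      unfolding e_def power_sum by (rule prod.cong) (auto simp: g_def power_mult[symmetric] mult.commute simp del: of_nat_Suc)
    then show ?thesis by (simp add: poly_eval_def comb_def)
  qed
  have "alternating (Rn n) (PTF n k) (card ?A) g"
  proof (rule alternating_curve[where x = "\<lambda>i. real (Suc i)"])
    have "(1 + k) choose k \<le> (n + k) choose k" using n by (intro binomial_right_mono) simp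
    then show "2 \<le> card ?A" using k by (simp add: card_exponents)
    show "inj_on g {..<4 * card ?A}"
    proof (rule inj_onI)
      fix i j assume "g i = g j"
      then have "g i 0 = g j 0" by simp
      then show "i = j" using n by (simp add: g_def)
    qed
    show "{g i} \<in> sets (Rn n)" for i by (rule singleton_sets_Rn[OF g])
    show "PTF n k \<subseteq> two_valued (Rn n)"
      unfolding PTF_def using restrict_pm_sign_two_valued by blast
    show "\<exists>h\<in>PTF n k. \<forall>i<4 * card ?A. h (g i) = pm_sign (comb c (real (Suc i)))" for c
      unfolding PTF_def using g by (auto simp: eval intro!: exI[of _ c])
    show "(\<forall>i<4 * card ?A. h (g i) = -1) \<or> (\<exists>c. \<forall>i<4 * card ?A. h (g i) = pm_sign (comb c (real (Suc i))))"
      if "h \<in> PTF n k" for h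
      using that g unfolding PTF_def by (auto simp: eval)
  qed (use g in auto)
  then show ?thesis unfolding card_exponents by blast
qed

section \<open>Trigonometric polynomials and balls\<close>

definition trig :: "nat \<Rightarrow> nat \<Rightarrow> real \<Rightarrow> real" where
  "trig d j t = (if j = 0 then 1 else if j \<le> d then cos (real j * t) else sin (real (j - d) * t))"

lemma sum_trig:
  "(\<Sum>j\<le>2 * d. c j * trig d j t) =
     c 0 + (\<Sum>k=1..d. c k * cos (real k * t)) + (\<Sum>k=1..d. c (d + k) * sin (real k * t))"
proof -
  have "{..2 * d} = {0} \<union> {1..d} \<union> (+) d ` {1..d}"
  proof (intro set_eqI iffI)
    fix j assume "j \<in> {..2 * d}"
    then have "j = 0 \<or> j \<in> {1..d} \<or> j - d \<in> {1..d} \<and> j = d + (j - d)" by auto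
    then show "j \<in> {0} \<union> {1..d} \<union> (+) d ` {1..d}" by blast
  qed auto
  then have "(\<Sum>j\<le>2 * d. c j * trig d j t) =
      c 0 * trig d 0 t + (\<Sum>j=1..d. c j * trig d j t) + (\<Sum>j\<in>(+) d ` {1..d}. c j * trig d j t)"
    by (simp add: sum.union_disjoint)
  also have "(\<Sum>j\<in>(+) d ` {1..d}. c j * trig d j t) = (\<Sum>k=1..d. c (d + k) * sin (real k * t))"
    by (subst sum.reindex) (auto simp: trig_def)
  also have "(\<Sum>j=1..d. c j * trig d j t) = (\<Sum>k=1..d. c k * cos (real k * t))"
    by (rule sum.cong) (auto simp: trig_def)
  finally show ?thesis by (simp add: trig_def)
qed

text \<open>
  Multiplied by \<open>cis (d * t)\<close>, a trigonometric polynomial of degree \<open>d\<close> becomes a complex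
  polynomial of degree \<open>2 * d\<close> in \<open>cis t\<close>.
\<close>

lemma chebyshev_trig: "chebyshev_system {..2 * d} (trig d) {0..1}"
proof
  fix c :: "nat \<Rightarrow> real" assume c: "\<exists>j\<in>{..2 * d}. c j \<noteq> 0"
  let ?Z = "{t \<in> {0..1}. (\<Sum>j\<le>2 * d. c j * trig d j t) = 0}"
  \<comment> \<open>With z = cis t, the sum w z^k + cnj w z^(-k) is twice the real part of w z^k,
    which is the part of frequency k of the combination.\<close>
  define w where "w k = Complex (c k / 2) (- c (d + k) / 2)" for k
  define q where "q = monom (of_real (c 0)) d + (\<Sum>k=1..d. monom (w k) (d + k) + monom (cnj (w k)) (d - k))"
  have "poly q (cis t) = cis (real d * t) * of_real (\<Sum>j\<le>2 * d. c j * trig d j t)" for t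
  proof -
    have "w k * cis t ^ (d + k) + cnj (w k) * cis t ^ (d - k) =
        cis (real d * t) * of_real (c k * cos (real k * t) + c (d + k) * sin (real k * t))" if "k \<in> {1..d}" for k
    proof -
      have 1: "cis t ^ (d + k) = cis (real d * t) * cis (real k * t)"
        by (simp add: Complex.DeMoivre cis_mult distrib_right)
      have 2: "cis t ^ (d - k) = cis (real d * t) * cnj (cis (real k * t))"
        using that by (simp add: Complex.DeMoivre cis_cnj cis_mult of_nat_diff left_diff_distrib)
      have 3: "w k * cis (real k * t) + cnj (w k) * cnj (cis (real k * t)) =
          of_real (c k * cos (real k * t) + c (d + k) * sin (real k * t))"
        by (simp add: complex_eq_iff w_def)
      have "a * (X * Y) + b * (X * Y') = X * (a * Y + b * Y')" for a b X Y Y' :: complex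
        by (simp add: algebra_simps)
      then show ?thesis by (simp only: 1 2 3)
    qed
    then have "poly q (cis t) = of_real (c 0) * cis (real d * t) +
        (\<Sum>k=1..d. cis (real d * t) * of_real (c k * cos (real k * t) + c (d + k) * sin (real k * t)))"
      by (simp add: q_def poly_monom poly_sum Complex.DeMoivre)
    moreover have "of_real (\<Sum>j\<le>2 * d. c j * trig d j t) = (of_real (c 0) +
        (\<Sum>k=1..d. of_real (c k * cos (real k * t) + c (d + k) * sin (real k * t))) :: complex)"
      unfolding sum_trig by (simp add: sum.distrib add.assoc)
    ultimately show ?thesis
      by (simp only: distrib_left sum_distrib_left mult.commute[of "of_real (c 0)"])
  qed
  note eval = this
  have "q \<noteq> 0"
  proof
    assume "q = 0"
    have cf: "coeff q i = (if i = d then of_real (c 0) else 0) +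
        (\<Sum>k=1..d. (if i = d + k then w k else 0) + (if i = d - k then cnj (w k) else 0))" for i
      by (simp add: q_def coeff_sum) (auto intro!: sum.cong)
    have "(\<Sum>k=1..d. (if d = d + k then w k else 0) + (if d = d - k then cnj (w k) else 0)) = 0"
      by (rule sum.neutral) auto
    then have "c 0 = 0" using cf[of d] \<open>q = 0\<close> by simp
    moreover have "c k = 0 \<and> c (d + k) = 0" if "k \<in> {1..d}" for k
    proof -
      have "(\<Sum>k'=1..d. (if d + k = d + k' then w k' else 0) + (if d + k = d - k' then cnj (w k') else 0)) =
          (\<Sum>k'=1..d. if k = k' then w k' else 0)"
        using that by (intro sum.cong) auto
      then have "w k = 0" using cf[of "d + k"] \<open>q = 0\<close> that by simp
      then show ?thesis by (simp add: w_def complex_eq_iff)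
    qed
    moreover have "j = 0 \<or> j \<in> {1..d} \<or> j - d \<in> {1..d} \<and> j = d + (j - d)" if "j \<in> {..2 * d}" for j
      using that by auto
    ultimately show False using c by metis
  qed
  have "degree q \<le> 2 * d"
    unfolding q_def by (intro degree_add_le degree_sum_le) (auto intro: order.trans[OF degree_monom_le])
  \<comment> \<open>Distinct zeros have to give distinct roots of \<open>q\<close>. The interval
    lies in [0, pi], so already the real part of \<open>cis\<close> is injective on it.\<close>
  have inj: "inj_on cis {0..1}"
  proof (rule inj_onI)
    fix s t :: real assume st: "s \<in> {0..1}" "t \<in> {0..1}" "cis s = cis t"
    have "cos s = cos t" using arg_cong[OF st(3), of Re] by simp
    moreover have "1 \<le> pi" using pi_gt3 by simp
    ultimately show "s = t" using st(1,2) by (metis atLeastAtMost_iff cos_inj_pi order.trans)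
  qed
  have fin: "finite {z. poly q z = 0}" using \<open>q \<noteq> 0\<close> by (rule poly_roots_finite)
  have sub: "cis ` ?Z \<subseteq> {z. poly q z = 0}"
    by (auto simp: eval simp del: of_real_sum)
  have inj_Z: "inj_on cis ?Z" using inj by (rule inj_on_subset) auto
  have "card ?Z = card (cis ` ?Z)" using inj_Z by (simp add: card_image)
  also have "\<dots> \<le> card {z. poly q z = 0}" using sub fin by (intro card_mono)
  also have "\<dots> \<le> 2 * d" using card_poly_roots_bound[OF \<open>q \<noteq> 0\<close>] \<open>degree q \<le> 2 * d\<close> by simp
  finally show "finite ?Z \<and> card ?Z < card {..2 * d}"
    using finite_imageD[OF finite_subset[OF sub fin] inj_Z] by simp
next
  show "continuous_on {0..1} (trig d j)" for j
    unfolding trig_def by (cases "j = 0"; cases "j \<le> d") (auto intro!: continuous_intros)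
qed (auto simp: is_interval_1)

text \<open>On the line y = 0 the members of the class are exactly the signs of combinations of the
  system, up to renumbering the coefficients.\<close>

lemma alternating_trig_signs:
  assumes d: "2 \<le> d"
  shows "\<exists>g. alternating borel (trig_signs d) (2 * d + 1) g"
proof -
  interpret chebyshev_system "{..2 * d}" "trig d" "{0..1}" by (rule chebyshev_trig)
  define x where "x i = real i / real (4 * (2 * d + 1))" for i
  define g where "g i = (x i, 0 :: real)" for i
  have mono: "x i < x j" if "i < j" for i j
    using that unfolding x_def by (intro divide_strict_right_mono) auto
  have inj: "inj_on g A" for A
  proof (rule inj_onI)
    fix i j assume "g i = g j"
    then show "i = j" using mono[of i j] mono[of j i] by (cases i j rule: linorder_cases) (auto simp: g_def)
  qed
  have "alternating borel (trig_signs d) (card {..2 * d}) g"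
  proof (rule alternating_curve[where x = x])
    show "x i \<in> {0..1}" if "i < 4 * card {..2 * d}" for i
      using that by (auto simp: x_def divide_le_eq)
    show "trig_signs d \<subseteq> two_valued borel"
      by (auto simp: trig_signs_def two_valued_def)
    show "\<exists>h\<in>trig_signs d. \<forall>i<4 * card {..2 * d}. h (g i) = pm_sign (comb c (x i))" for c
    proof
      show "(\<lambda>(x, y). pm_sign (c 0 + (\<Sum>k=1..d. c k * cos (real k * x)) + (\<Sum>k=1..d. c (d + k) * sin (real k * x)) - y))
          \<in> trig_signs d"
        unfolding trig_signs_def
        by (rule CollectI, rule exI[of _ "c 0"], rule exI[of _ c], rule exI[of _ "\<lambda>k. c (d + k)"]) simp
    qed (simp add: g_def comb_def sum_trig)
    show "(\<forall>i<4 * card {..2 * d}. h (g i) = -1) \<or> (\<exists>c. \<forall>i<4 * card {..2 * d}. h (g i) = pm_sign (comb c (x i)))"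
      if "h \<in> trig_signs d" for h
    proof -
      obtain t a b where h: "h = (\<lambda>(x, y). pm_sign (t + (\<Sum>k=1..d. a k * cos (real k * x)) + (\<Sum>k=1..d. b k * sin (real k * x)) - y))"
        using \<open>h \<in> trig_signs d\<close> unfolding trig_signs_def by blast
      define c where "c j = (if j = 0 then t else if j \<le> d then a j else b (j - d))" for j
      have "(\<Sum>k=1..d. c k * cos (real k * s)) = (\<Sum>k=1..d. a k * cos (real k * s))"
           "(\<Sum>k=1..d. c (d + k) * sin (real k * s)) = (\<Sum>k=1..d. b k * sin (real k * s))" for s
        by (rule sum.cong; auto simp: c_def)+
      then have "h (g i) = pm_sign (comb c (x i))" for i
        unfolding comb_def sum_trig by (simp add: h g_def c_def)
      then show ?thesis by blast
    qed
  qed (use d mono inj in auto)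
  then show ?thesis by auto
qed

text \<open>
  A curve on a sphere, on which the squared distance to a point is a trigonometric polynomial.
  If \<open>n\<close> is odd, the last coordinate is 0.
\<close>

lemma alternating_balls:
  assumes n: "2 \<le> n"
  shows "\<exists>g. alternating (Rn n) (balls n) (2 * (n div 2) + 1) g"
proof -
  define m where "m = n div 2"
  have m: "1 \<le> m" "2 * m \<le> n" using n unfolding m_def by linarith+
  interpret chebyshev_system "{..2 * m}" "trig m" "{0..1}" by (rule chebyshev_trig)
  define x where "x i = real i / real (4 * (2 * m + 1))" for i
  define g where "g i = (\<lambda>j\<in>{..<n}. if j < 2 * m then trig m (Suc j) (x i) else 0)" for i
  have g: "g i \<in> space (Rn n)" for i by (simp add: g_def space_Rn)
  have mono: "x i < x j" if "i < j" for i j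
    using that unfolding x_def by (intro divide_strict_right_mono) auto
  have x: "x i \<in> {0..1}" if "i < 4 * card {..2 * m}" for i
    using that by (auto simp: x_def divide_le_eq)
  have inj: "inj_on g {..<4 * card {..2 * m}}"
  proof (rule inj_onI)
    fix i j assume ij: "i \<in> {..<4 * card {..2 * m}}" "j \<in> {..<4 * card {..2 * m}}" "g i = g j"
    then have "g i 0 = g j 0" by simp
    then have "cos (x i) = cos (x j)" using m by (simp add: g_def trig_def split: if_splits)
    moreover have "x i \<in> {0..1}" "x j \<in> {0..1}" using ij(1,2) by (blast intro: x)+
    moreover have "1 \<le> pi" using pi_gt3 by simp
    ultimately have "x i = x j" by (metis atLeastAtMost_iff cos_inj_pi order.trans)
    then show "i = j" using mono[of i j] mono[of j i] by (cases i j rule: linorder_cases) auto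
  qed
  have comb: "comb c t = c 0 + (\<Sum>j<2 * m. c (Suc j) * trig m (Suc j) t)" for c t
    unfolding comb_def by (subst sum.atMost_shift) (simp add: trig_def)
  \<comment> \<open>The coordinates pair up as cos (k t) and sin (k t), so the curve lies on a
    sphere of squared radius \<open>m\<close>.\<close>
  have unit: "(\<Sum>j<2 * m. trig m (Suc j) t ^ 2) = real m" for t
  proof -
    have "(\<Sum>j<m + m. trig m (Suc j) t ^ 2) = (\<Sum>j<m. trig m (Suc j) t ^ 2) + (\<Sum>j<m. trig m (Suc (m + j)) t ^ 2)"
    proof -
      have "(\<Sum>j<a + b. F j) = (\<Sum>j<a. F j) + (\<Sum>j<b. F (a + j))" for a b and F :: "nat \<Rightarrow> real"
        by (induction b) auto
      then show ?thesis .
    qed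
    also have "\<dots> = (\<Sum>j<m. cos (real (Suc j) * t) ^ 2 + sin (real (Suc j) * t) ^ 2)"
      unfolding sum.distrib by (intro arg_cong2[where f = "(+)"] sum.cong) (auto simp: trig_def simp del: of_nat_Suc)
    finally show ?thesis by (simp add: mult_2 del: of_nat_Suc)
  qed
  have dist: "(\<Sum>j<n. (g i j - z j) ^ 2) =
      real m - 2 * (\<Sum>j<2 * m. z j * trig m (Suc j) (x i)) + (\<Sum>j<n. z j ^ 2)" for i z
  proof -
    have "(\<Sum>j<n. (g i j - z j) ^ 2) = (\<Sum>j<n. g i j ^ 2) - 2 * (\<Sum>j<n. z j * g i j) + (\<Sum>j<n. z j ^ 2)"
      by (simp add: power2_diff sum.distrib sum_subtractf sum_distrib_left mult_ac)
    moreover have "(\<Sum>j<n. g i j ^ 2) = (\<Sum>j<2 * m. trig m (Suc j) (x i) ^ 2)"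
      using m by (intro sum.mono_neutral_cong_right) (auto simp: g_def)
    moreover have "(\<Sum>j<n. z j * g i j) = (\<Sum>j<2 * m. z j * trig m (Suc j) (x i))"
      using m by (intro sum.mono_neutral_cong_right) (auto simp: g_def)
    ultimately show ?thesis by (simp add: unit)
  qed
  have "alternating (Rn n) (balls n) (card {..2 * m}) g"
  proof (rule alternating_curve[where x = x])
    show "{g i} \<in> sets (Rn n)" for i by (rule singleton_sets_Rn[OF g])
    show "balls n \<subseteq> two_valued (Rn n)"
      unfolding balls_def by (rule subsetI, elim CollectE exE conjE) (simp only: restrict_pm_sign_two_valued)
    show "\<exists>h\<in>balls n. \<forall>i<4 * card {..2 * m}. h (g i) = pm_sign (comb c (x i))" for c
    proof -
      \<comment> \<open>A positive factor leaves the signs of the combination unchanged, and this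
        one makes \<open>s * c 0\<close> at least -1, so that \<open>R\<close> is nonnegative and
        can be a squared radius. The centre has halved coefficients as coordinates because the cross
        term of a squared distance carries a factor 2.\<close>
      define s where "s = 1 / (\<bar>c 0\<bar> + 1)"
      define z where "z = (\<lambda>j\<in>{..<n}. if j < 2 * m then s * c (Suc j) / 2 else 0)"
      define R where "R = s * c 0 + real m + (\<Sum>j<n. z j ^ 2)"
      have s: "0 < s" by (simp add: s_def)
      have "- 1 \<le> s * c 0" by (simp add: s_def field_simps)
      then have R: "0 \<le> R" using m(1) by (simp add: R_def sum_nonneg)
      let ?h = "restrict (\<lambda>y. pm_sign (sqrt R - L2_set (\<lambda>j. y j - z j) {..<n})) (space (Rn n))"
      have "?h (g i) = pm_sign (comb c (x i))" for i
      proof -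
        have "(\<Sum>j<2 * m. z j * trig m (Suc j) (x i)) = (\<Sum>j<2 * m. s * c (Suc j) / 2 * trig m (Suc j) (x i))"
          using m by (intro sum.cong) (auto simp: z_def)
        then have eq: "s * comb c (x i) = R - (\<Sum>j<n. (g i j - z j) ^ 2)"
          unfolding dist comb R_def by (simp add: distrib_left sum_distrib_left mult_ac)
        have "sqrt R - L2_set (\<lambda>j. g i j - z j) {..<n} \<ge> 0 \<longleftrightarrow> 0 \<le> s * comb c (x i)"
          unfolding eq L2_set_def diff_ge_0_iff_ge by (rule real_sqrt_le_iff)
        then show ?thesis using g s by (simp add: pm_sign_def zero_le_mult_iff)
      qed
      moreover have "?h \<in> balls n"
        unfolding balls_def
        by (rule CollectI, rule exI[of _ "sqrt R"], rule exI[of _ z]) (simp add: z_def space_Rn)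
      ultimately show ?thesis by blast
    qed
    show "(\<forall>i<4 * card {..2 * m}. h (g i) = -1) \<or> (\<exists>c. \<forall>i<4 * card {..2 * m}. h (g i) = pm_sign (comb c (x i)))"
      if "h \<in> balls n" for h
    proof -
      obtain r z where h: "h = restrict (\<lambda>y. pm_sign (r - L2_set (\<lambda>j. y j - z j) {..<n})) (space (Rn n))"
        using \<open>h \<in> balls n\<close> unfolding balls_def by blast
      show ?thesis
      proof (cases "0 \<le> r")
        case True
        define c where "c j = (if j = 0 then r ^ 2 - real m - (\<Sum>j<n. z j ^ 2) else 2 * z (j - 1))" for j
        have "h (g i) = pm_sign (comb c (x i))" for i
        proof -
          have "r ^ 2 - (\<Sum>j<n. (g i j - z j) ^ 2) = comb c (x i)"
            unfolding dist comb by (simp add: c_def sum_distrib_left mult_ac)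
          moreover have "L2_set (\<lambda>j. g i j - z j) {..<n} \<le> r \<longleftrightarrow> (\<Sum>j<n. (g i j - z j) ^ 2) \<le> r ^ 2"
          proof -
            have "L2_set (\<lambda>j. g i j - z j) {..<n} \<le> r \<longleftrightarrow> sqrt (\<Sum>j<n. (g i j - z j) ^ 2) \<le> sqrt (r ^ 2)"
              unfolding L2_set_def using True by (simp del: real_sqrt_le_iff)
            then show ?thesis by (simp only: real_sqrt_le_iff)
          qed
          ultimately show ?thesis using g by (simp add: h pm_sign_def)
        qed
        then show ?thesis by blast
      next
        \<comment> \<open>A negative radius gives the empty ball.\<close>
        case False
        have "h (g i) = -1" for i
        proof -
          have "0 \<le> L2_set (\<lambda>j. g i j - z j) {..<n}" by (rule L2_set_nonneg)
          then have "\<not> L2_set (\<lambda>j. g i j - z j) {..<n} \<le> r" using False by linarith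
          then show ?thesis using g by (simp add: h pm_sign_def)
        qed
        then show ?thesis by blast
      qed
    qed
  qed (use m mono inj x g in auto)
  then show ?thesis by (auto simp: m_def)
qed

theorem theorem5p10:
  "\<exists>\<epsilon>\<^sub>0 > 0. \<exists>c > 0. \<forall>\<epsilon> :: real. 0 < \<epsilon> \<and> \<epsilon> < \<epsilon>\<^sub>0 \<longrightarrow>
     (\<forall>n k :: nat. n \<ge> 1 \<and> k \<ge> 1 \<longrightarrow>
        (let N = real ((n + k) choose k) in
           ereal (c * N / ln N) \<le> ereal_of_enat (m_test (Rn n) \<epsilon> (PTF n k)) \<and>
           ereal (c * N / ln N) \<le> ereal_of_enat (q_test0 (Rn n) \<epsilon> (PTF n k)))) \<and>
     (\<forall>n :: nat. n \<ge> 2 \<longrightarrow>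
        ereal (c * real n / ln (real n)) \<le> ereal_of_enat (m_test (Rn n) \<epsilon> (balls n)) \<and>
        ereal (c * real n / ln (real n)) \<le> ereal_of_enat (q_test0 (Rn n) \<epsilon> (balls n))) \<and>
     (\<forall>d :: nat. d \<ge> 2 \<longrightarrow>
        ereal (c * real d / ln (real d)) \<le> ereal_of_enat (m_test borel \<epsilon> (trig_signs d)) \<and>
        ereal (c * real d / ln (real d)) \<le> ereal_of_enat (q_test0 borel \<epsilon> (trig_signs d)))"
proof -
  define c :: real where "c = 1 / 1320000000"
  note bounds = test_lower_bounds[folded c_def]
  have PTF: "let N = real ((n + k) choose k) in
      ereal (c * N / ln N) \<le> ereal_of_enat (m_test (Rn n) \<epsilon> (PTF n k)) \<and>
      ereal (c * N / ln N) \<le> ereal_of_enat (q_test0 (Rn n) \<epsilon> (PTF n k))"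
    if \<epsilon>: "\<epsilon> \<le> 1 / 240" and "1 \<le> n" "1 \<le> k" for \<epsilon> n k
  proof -
    obtain g where g: "alternating (Rn n) (PTF n k) ((n + k) choose k) g"
      using alternating_PTF \<open>1 \<le> n\<close> \<open>1 \<le> k\<close> by blast
    then have "2 \<le> (n + k) choose k" by (rule alternating.D)
    from bounds[OF g this _ _ \<epsilon>] show ?thesis by (simp add: Let_def)
  qed
  have balls: "ereal (c * real n / ln (real n)) \<le> ereal_of_enat (m_test (Rn n) \<epsilon> (balls n)) \<and>
      ereal (c * real n / ln (real n)) \<le> ereal_of_enat (q_test0 (Rn n) \<epsilon> (balls n))"
    if \<epsilon>: "\<epsilon> \<le> 1 / 240" and n: "2 \<le> n" for \<epsilon> n
  proof -
    obtain g where g: "alternating (Rn n) (balls n) (2 * (n div 2) + 1) g"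
      using alternating_balls[OF n] by blast
    have "n \<le> 2 * (n div 2) + 1" "2 * (n div 2) + 1 \<le> 3 * n" using n by auto
    from bounds[OF g n this \<epsilon>] show ?thesis by blast
  qed
  have trig: "ereal (c * real d / ln (real d)) \<le> ereal_of_enat (m_test borel \<epsilon> (trig_signs d)) \<and>
      ereal (c * real d / ln (real d)) \<le> ereal_of_enat (q_test0 borel \<epsilon> (trig_signs d))"
    if \<epsilon>: "\<epsilon> \<le> 1 / 240" and d: "2 \<le> d" for \<epsilon> d
  proof -
    obtain g where g: "alternating borel (trig_signs d) (2 * d + 1) g"
      using alternating_trig_signs[OF d] by blast
    have "d \<le> 2 * d + 1" "2 * d + 1 \<le> 3 * d" using d by auto
    from bounds[OF g d this \<epsilon>] show ?thesis by blast
  qed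
  show ?thesis
  proof (rule exI[of _ "1 / 240"], rule conjI, simp, rule exI[of _ c], rule conjI, simp add: c_def,
      intro allI impI)
    fix \<epsilon> :: real assume "0 < \<epsilon> \<and> \<epsilon> < 1 / 240"
    then have "\<epsilon> \<le> 1 / 240" by simp
    note PTF[OF this] balls[OF this] trig[OF this]
    then show "(\<forall>n k :: nat. n \<ge> 1 \<and> k \<ge> 1 \<longrightarrow>
        (let N = real ((n + k) choose k) in
           ereal (c * N / ln N) \<le> ereal_of_enat (m_test (Rn n) \<epsilon> (PTF n k)) \<and>
           ereal (c * N / ln N) \<le> ereal_of_enat (q_test0 (Rn n) \<epsilon> (PTF n k)))) \<and>
     (\<forall>n :: nat. n \<ge> 2 \<longrightarrow>
        ereal (c * real n / ln (real n)) \<le> ereal_of_enat (m_test (Rn n) \<epsilon> (balls n)) \<and>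
        ereal (c * real n / ln (real n)) \<le> ereal_of_enat (q_test0 (Rn n) \<epsilon> (balls n))) \<and>
     (\<forall>d :: nat. d \<ge> 2 \<longrightarrow>
        ereal (c * real d / ln (real d)) \<le> ereal_of_enat (m_test borel \<epsilon> (trig_signs d)) \<and>
        ereal (c * real d / ln (real d)) \<le> ereal_of_enat (q_test0 borel \<epsilon> (trig_signs d)))"
      by blast
  qed
qed

end
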